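(* Let $n \geq 1$ and let $x_1,\dots,x_{2n}$ and $t$ be indeterminates. Then $$ \sum_{\lambda'\ \mathrm{even}}\ \prod_{i=2,4,6,\dots}^{2n}\left(1-t^{\lambda_i-i+2n+1}\right) s_{\lambda}(x_1,\dots,x_{2n}) = \prod_{1\leq i<j\leq 2n}\frac{1}{(x_i-x_j)}\ \mathrm{Pf}\left[\frac{(x_i-x_j)(1-t)}{(1-x_i x_j)(1-t x_i x_j)}\right]_{1\leq i<j\leq 2n}, $$ where the sum is over all partitions $\lambda=(\lambda_1\geq\cdots\geq\lambda_{2n}\geq 0)$ with at most $2n$ non-zero parts whose conjugate partition $\lambda'$ has only even parts (equivalently $\lambda_{2k-1}=\lambda_{2k}$ for all $1\leq k\leq n$), and the product on the left runs over the even integers $i$ with $2\leq i\leq 2n$.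
   Context: A partition is a finite weakly decreasing sequence of positive integers (possibly empty); a partition with at most $2n$ parts is padded with zeros so that $\lambda_1,\dots,\lambda_{2n}$ are all defined. $\lambda'$ denotes the conjugate (transpose) partition. The Schur polynomial of a partition $\lambda$ with at most $2n$ parts is $$ s_{\lambda}(x_1,\dots,x_{2n})=\frac{\det\left[x_i^{\lambda_j-j+2n}\right]_{1\leq i,j\leq 2n}}{\prod_{1\leq i<j\leq 2n}(x_i-x_j)} . $$ $\mathrm{Pf}[a_{ij}]_{1\leq i<j\leq 2n}$ denotes the Pfaffian of the $2n\times 2n$ antisymmetric matrix with entries $a_{ij}$ above the diagonal. The identity is understood as one of formal power series in $x_1,\dots,x_{2n}$ with coefficients polynomial in $t$, the entries of the Pfaffian being expanded as power series in the $x_i$. *)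

theory Defs
  imports
    "HOL-Combinatorics.Permutations"
    "HOL-Computational_Algebra.Polynomial"
    "HOL-Computational_Algebra.Polynomial_Factorial"
    "HOL-Analysis.Infinite_Sum"
    "Jordan_Normal_Form.Determinant"
    "HOL-Library.Poly_Mapping"
begin

section \<open>Multivariate formal power series\<close>

text \<open>
  Formal power series in variables indexed by the natural numbers: arbitrary functions from
  monomials (finitely supported exponent vectors) to coefficients, with the Cauchy product.
  The ring of power series in the first few variables is the subring of those series all of whose
  monomials involve these variables only.
\<close>

typedef 'a mfps = "UNIV :: ((nat \<Rightarrow>\<^sub>0 nat) \<Rightarrow> 'a) set"
  morphisms mfps_nth Abs_mfps
  by simp

setup_lifting type_definition_mfps

lemma mfps_eqI: "(\<And>m. mfps_nth f m = mfps_nth g m) \<Longrightarrow> f = g"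
  by transfer auto

lemma mfps_eq_iff: "f = g \<longleftrightarrow> (\<forall>m. mfps_nth f m = mfps_nth g m)"
  using mfps_eqI by auto

lemma finite_pm_bounded:
  fixes V :: "nat set" and d :: nat
  assumes "finite V"
  shows "finite {m :: nat \<Rightarrow>\<^sub>0 nat. Poly_Mapping.keys m \<subseteq> V \<and> (\<forall>i. Poly_Mapping.lookup m i \<le> d)}"
proof -
  let ?S = "{m :: nat \<Rightarrow>\<^sub>0 nat. Poly_Mapping.keys m \<subseteq> V \<and> (\<forall>i. Poly_Mapping.lookup m i \<le> d)}"
  have "Poly_Mapping.lookup ` ?S \<subseteq> {f. \<forall>x. (x \<in> V \<longrightarrow> f x \<in> {..d}) \<and> (x \<notin> V \<longrightarrow> f x = 0)}"
    by (auto simp: in_keys_iff)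
  moreover have "finite {f. \<forall>x. (x \<in> V \<longrightarrow> f x \<in> {..d}) \<and> (x \<notin> V \<longrightarrow> f x = (0::nat))}"
    by (rule finite_set_of_finite_funs) (use assms in auto)
  ultimately have "finite (Poly_Mapping.lookup ` ?S)" by (rule finite_subset)
  moreover have "inj_on Poly_Mapping.lookup ?S" by (auto intro!: inj_onI poly_mapping_eqI)
  ultimately show ?thesis by (rule finite_imageD)
qed

definition splits :: "(nat \<Rightarrow>\<^sub>0 nat) \<Rightarrow> ((nat \<Rightarrow>\<^sub>0 nat) \<times> (nat \<Rightarrow>\<^sub>0 nat)) set" where
  "splits m = {(a, b). a + b = m}"

lemma in_splits [simp]: "(a, b) \<in> splits m \<longleftrightarrow> a + b = m"
  by (simp add: splits_def)

lemma finite_splits [simp]: "finite (splits m)"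
proof -
  define d where "d = (\<Sum>i\<in>Poly_Mapping.keys m. Poly_Mapping.lookup m i)"
  let ?S = "{a :: nat \<Rightarrow>\<^sub>0 nat. Poly_Mapping.keys a \<subseteq> Poly_Mapping.keys m \<and> (\<forall>i. Poly_Mapping.lookup a i \<le> d)}"
  have *: "Poly_Mapping.lookup m i \<le> d" for i
    unfolding d_def by (cases "i \<in> Poly_Mapping.keys m") (auto intro: member_le_sum simp: in_keys_iff)
  have "splits m \<subseteq> ?S \<times> ?S"
  proof safe
    fix a b assume "(a, b) \<in> splits m"
    then have l: "Poly_Mapping.lookup m i = Poly_Mapping.lookup a i + Poly_Mapping.lookup b i" for i by (auto simp: lookup_add)
    show "x \<in> Poly_Mapping.keys m" if "x \<in> Poly_Mapping.keys a" for x using that l[of x] by (simp add: in_keys_iff)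
    show "x \<in> Poly_Mapping.keys m" if "x \<in> Poly_Mapping.keys b" for x using that l[of x] by (simp add: in_keys_iff)
    show "Poly_Mapping.lookup a i \<le> d" for i using *[of i] l[of i] by linarith
    show "Poly_Mapping.lookup b i \<le> d" for i using *[of i] l[of i] by linarith
  qed
  moreover have "finite (?S \<times> ?S)"
    by (intro finite_cartesian_product finite_pm_bounded finite_keys)
  ultimately show ?thesis by (rule finite_subset)
qed

lemma splits_0 [simp]: "splits 0 = {(0, 0)}"
  by (auto simp: splits_def poly_mapping_eq_iff lookup_add fun_eq_iff)

instantiation mfps :: (comm_ring_1) comm_ring_1
begin

lift_definition zero_mfps :: "'a mfps" is "\<lambda>_. 0" .
lift_definition one_mfps :: "'a mfps" is "\<lambda>m. if m = 0 then 1 else 0" .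
lift_definition plus_mfps :: "'a mfps \<Rightarrow> 'a mfps \<Rightarrow> 'a mfps" is "\<lambda>f g m. f m + g m" .
lift_definition minus_mfps :: "'a mfps \<Rightarrow> 'a mfps \<Rightarrow> 'a mfps" is "\<lambda>f g m. f m - g m" .
lift_definition uminus_mfps :: "'a mfps \<Rightarrow> 'a mfps" is "\<lambda>f m. - f m" .
lift_definition times_mfps :: "'a mfps \<Rightarrow> 'a mfps \<Rightarrow> 'a mfps"
  is "\<lambda>f g m. \<Sum>(a, b)\<in>splits m. f a * g b" .

instance
proof
  fix f g h :: "'a mfps"
  show "f + g + h = f + (g + h)" "f + g = g + f" "0 + f = f" "- f + f = 0" "f - g = f + - g"
    by (transfer; force simp: algebra_simps)+
  show "(0 :: 'a mfps) \<noteq> 1"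
    by transfer (metis zero_neq_one)
  show "f * g = g * f"
  proof (transfer, rule ext)
    fix f g :: "(nat \<Rightarrow>\<^sub>0 nat) \<Rightarrow> 'a" and m
    show "(\<Sum>(a, b)\<in>splits m. f a * g b) = (\<Sum>(a, b)\<in>splits m. g a * f b)"
      by (rule sum.reindex_bij_witness[of _ "\<lambda>(a, b). (b, a)" "\<lambda>(a, b). (b, a)"])
         (auto simp: add.commute mult.commute)
  qed
  show "(f + g) * h = f * h + g * h"
    by transfer (auto simp: algebra_simps sum.distrib case_prod_unfold)
  show "1 * f = f"
  proof (transfer, rule ext)
    fix f :: "(nat \<Rightarrow>\<^sub>0 nat) \<Rightarrow> 'a" and m
    have "(\<Sum>(a, b)\<in>splits m. (if a = 0 then 1 else 0) * f b) =
          (\<Sum>(a, b)\<in>{(0 :: nat \<Rightarrow>\<^sub>0 nat, m)}. (if a = 0 then 1 else 0) * f b)"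
      by (rule sum.mono_neutral_right) (auto split: if_splits)
    then show "(\<Sum>(a, b)\<in>splits m. (if a = 0 then 1 else 0) * f b) = f m" by simp
  qed
  show "f * g * h = f * (g * h)"
  proof (transfer, rule ext)
    fix f g h :: "(nat \<Rightarrow>\<^sub>0 nat) \<Rightarrow> 'a" and m
    have "(\<Sum>(a, b)\<in>splits m. (\<Sum>(c, d)\<in>splits a. f c * g d) * h b) =
          (\<Sum>(p, q)\<in>Sigma (splits m) (\<lambda>p. splits (fst p)). f (fst q) * g (snd q) * h (snd p))"
      by (subst sum.Sigma [symmetric]) (auto simp: case_prod_unfold sum_distrib_right)
    also have "\<dots> = (\<Sum>(p, q)\<in>Sigma (splits m) (\<lambda>p. splits (snd p)).
                      f (fst p) * (g (fst q) * h (snd q)))"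
      by (rule sum.reindex_bij_witness
            [of _ "\<lambda>((a, b), (c, d)). ((a + c, d), (a, c))" "\<lambda>((a, b), (c, d)). ((c, d + b), (d, b))"])
         (auto simp: splits_def algebra_simps)
    also have "\<dots> = (\<Sum>(a, b)\<in>splits m. f a * (\<Sum>(c, d)\<in>splits b. g c * h d))"
      by (subst sum.Sigma [symmetric]) (auto simp: case_prod_unfold sum_distrib_left)
    finally show "(\<Sum>(a, b)\<in>splits m. (\<Sum>(c, d)\<in>splits a. f c * g d) * h b) =
                  (\<Sum>(a, b)\<in>splits m. f a * (\<Sum>(c, d)\<in>splits b. g c * h d))" .
  qed
qed

end

lemma mfps_nth_simps [simp]:
  "mfps_nth 0 m = 0"
  "mfps_nth 1 m = (if m = 0 then 1 else 0)"
  "mfps_nth (f + g) m = mfps_nth f m + mfps_nth g m"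
  "mfps_nth (f - g) m = mfps_nth f m - mfps_nth g m"
  "mfps_nth (- f) m = - mfps_nth f m"
  by (transfer; simp)+

lemma mfps_nth_mult: "mfps_nth (f * g) m = (\<Sum>(a, b)\<in>splits m. mfps_nth f a * mfps_nth g b)"
  by transfer simp

definition pm_deg :: "(nat \<Rightarrow>\<^sub>0 nat) \<Rightarrow> nat" where
  "pm_deg m = (\<Sum>i\<in>Poly_Mapping.keys m. Poly_Mapping.lookup m i)"

lemma pm_deg_superset:
  assumes "finite V" "Poly_Mapping.keys m \<subseteq> V"
  shows "pm_deg m = (\<Sum>i\<in>V. Poly_Mapping.lookup m i)"
  unfolding pm_deg_def
  by (rule sum.mono_neutral_left) (use assms in \<open>auto simp: in_keys_iff\<close>)

lemma pm_deg_add: "pm_deg (a + b) = pm_deg a + pm_deg b"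
proof -
  let ?V = "Poly_Mapping.keys a \<union> Poly_Mapping.keys b"
  have "Poly_Mapping.keys (a + b) \<subseteq> ?V" by (rule keys_add)
  then show ?thesis
    by (simp add: pm_deg_superset[of ?V] lookup_add sum.distrib)
qed

lemma keys_add_nat: "Poly_Mapping.keys (a + b :: nat \<Rightarrow>\<^sub>0 nat) = Poly_Mapping.keys a \<union> Poly_Mapping.keys b"
  by (auto simp: in_keys_iff lookup_add)

text \<open>Among the monomials of a non-empty set that only involve finitely many variables, there is
  one of least total degree that is lexicographically least among those of the same degree.\<close>

lemma ex_least_monomial:
  assumes V: "finite V" and S: "S \<noteq> {}" "\<And>m. m \<in> S \<Longrightarrow> Poly_Mapping.keys m \<subseteq> V"
  obtains m where "m \<in> S" "\<And>a. a \<in> S \<Longrightarrow> pm_deg m < pm_deg a \<or> (pm_deg m = pm_deg a \<and> m \<le> a)"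
proof -
  define d where "d = (LEAST d. \<exists>m\<in>S. pm_deg m = d)"
  have ex: "\<exists>m\<in>S. pm_deg m = d"
    unfolding d_def by (rule LeastI_ex) (use S in auto)
  have least: "d \<le> pm_deg m" if "m \<in> S" for m
    unfolding d_def by (rule Least_le) (use that in auto)
  let ?D = "{m \<in> S. pm_deg m = d}"
  have "?D \<subseteq> {m. Poly_Mapping.keys m \<subseteq> V \<and> (\<forall>i. Poly_Mapping.lookup m i \<le> d)}"
  proof safe
    fix m i assume m: "m \<in> S" "d = pm_deg m"
    show "Poly_Mapping.lookup m i \<le> pm_deg m"
      unfolding pm_deg_def by (cases "i \<in> Poly_Mapping.keys m") (auto intro: member_le_sum simp: in_keys_iff)
  qed (use S in auto)
  then have fin: "finite ?D" using finite_pm_bounded[OF V] finite_subset by blast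
  show ?thesis
  proof (rule that[of "Min ?D"])
    have "Min ?D \<in> ?D" using ex fin by (intro Min_in) auto
    then show "Min ?D \<in> S" by simp
    fix a assume "a \<in> S"
    show "pm_deg (Min ?D) < pm_deg a \<or> (pm_deg (Min ?D) = pm_deg a \<and> Min ?D \<le> a)"
      using \<open>Min ?D \<in> ?D\<close> least[OF \<open>a \<in> S\<close>] fin \<open>a \<in> S\<close>
      by (cases "pm_deg a = d") (auto intro!: Min_le)
  qed
qed

instance mfps :: (idom) idom
proof
  fix f g :: "'a mfps"
  assume "f \<noteq> 0" "g \<noteq> 0"
  then obtain p q where pq: "mfps_nth f p \<noteq> 0" "mfps_nth g q \<noteq> 0"
    by (auto simp: mfps_eq_iff)
  define V where "V = Poly_Mapping.keys p \<union> Poly_Mapping.keys q"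
  have V: "finite V" by (simp add: V_def)
  let ?S = "\<lambda>h :: 'a mfps. {m. mfps_nth h m \<noteq> 0 \<and> Poly_Mapping.keys m \<subseteq> V}"
  have "p \<in> ?S f" "q \<in> ?S g" using pq by (auto simp: V_def)
  then have ne: "?S f \<noteq> {}" "?S g \<noteq> {}" by blast+
  obtain a where a: "a \<in> ?S f"
      "\<And>m. m \<in> ?S f \<Longrightarrow> pm_deg a < pm_deg m \<or> (pm_deg a = pm_deg m \<and> a \<le> m)"
    by (rule ex_least_monomial[OF V ne(1)]) blast+
  obtain b where b: "b \<in> ?S g"
      "\<And>m. m \<in> ?S g \<Longrightarrow> pm_deg b < pm_deg m \<or> (pm_deg b = pm_deg m \<and> b \<le> m)"
    by (rule ex_least_monomial[OF V ne(2)]) blast+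
  have uniq: "c = a \<and> d = b"
    if cd: "c + d = a + b" "mfps_nth f c \<noteq> 0" "mfps_nth g d \<noteq> 0" for c d
  proof -
    have "Poly_Mapping.keys (c + d) \<subseteq> V"
      unfolding cd(1) using a(1) b(1) by (auto simp: keys_add_nat)
    then have "Poly_Mapping.keys c \<subseteq> V" "Poly_Mapping.keys d \<subseteq> V"
      by (simp_all add: keys_add_nat)
    then have "c \<in> ?S f" "d \<in> ?S g" using cd by simp_all
    note le = a(2)[OF this(1)] b(2)[OF this(2)]
    have "pm_deg c + pm_deg d = pm_deg a + pm_deg b"
      using cd(1) by (metis pm_deg_add)
    then have "a \<le> c" "b \<le> d" using le by auto
    then show ?thesis
      using cd(1) by (metis add_le_cancel_left add_le_cancel_right add_mono antisym)
  qed
  have "mfps_nth (f * g) (a + b) = (\<Sum>(c, d)\<in>{(a, b)}. mfps_nth f c * mfps_nth g d)"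
    unfolding mfps_nth_mult
    by (rule sum.mono_neutral_right) (use uniq in auto)
  then have "mfps_nth (f * g) (a + b) \<noteq> 0" using a(1) b(1) by simp
  then show "f * g \<noteq> 0" by auto
qed

text \<open>Exact division; the default value 0 for a non-divisible pair is never used below, since
  the Vandermonde product divides every alternant.\<close>

instantiation mfps :: (idom) divide
begin

definition divide_mfps :: "'a :: idom mfps \<Rightarrow> 'a mfps \<Rightarrow> 'a mfps" where
  "divide_mfps f g = (if g \<noteq> 0 \<and> g dvd f then THE q. f = q * g else 0)"

instance ..

end

instance mfps :: (idom) idom_divide
proof
  fix f g :: "'a mfps"
  show "f div 0 = 0" by (simp add: divide_mfps_def)
  assume "g \<noteq> 0"
  then have "(THE q. f * g = q * g) = f"
    by (intro the_equality) simp_all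
  with \<open>g \<noteq> 0\<close> show "f * g div g = f" by (simp add: divide_mfps_def)
qed

text \<open>
  The usual topology on formal power series: coefficientwise convergence with discrete
  coefficients. Hence a family of series is summable iff each monomial has a non-zero coefficient
  in only finitely many members, and the infinite sum is formed coefficientwise.
\<close>

instantiation mfps :: (type) topological_space
begin

definition open_mfps :: "'a mfps set \<Rightarrow> bool" where
  "open_mfps U \<longleftrightarrow>
     (\<forall>f\<in>U. \<exists>M. finite M \<and> (\<forall>g. (\<forall>m\<in>M. mfps_nth g m = mfps_nth f m) \<longrightarrow> g \<in> U))"

instance
proof
  show "open (UNIV :: 'a mfps set)"
    unfolding open_mfps_def by (intro ballI exI[of _ "{}"]) simp
next
  fix S T :: "'a mfps set"
  assume S: "open S" and T: "open T"
  show "open (S \<inter> T)"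
    unfolding open_mfps_def
  proof
    fix f assume "f \<in> S \<inter> T"
    then have "f \<in> S" "f \<in> T" by simp_all
    obtain M where M: "finite M" "\<And>g. (\<forall>m\<in>M. mfps_nth g m = mfps_nth f m) \<Longrightarrow> g \<in> S"
      using bspec[OF S[unfolded open_mfps_def] \<open>f \<in> S\<close>] by meson
    obtain N where N: "finite N" "\<And>g. (\<forall>m\<in>N. mfps_nth g m = mfps_nth f m) \<Longrightarrow> g \<in> T"
      using bspec[OF T[unfolded open_mfps_def] \<open>f \<in> T\<close>] by meson
    have "g \<in> S \<inter> T" if "\<forall>m\<in>M \<union> N. mfps_nth g m = mfps_nth f m" for g
      using M(2)[of g] N(2)[of g] that by simp
    with M(1) N(1)
    show "\<exists>M. finite M \<and> (\<forall>g. (\<forall>m\<in>M. mfps_nth g m = mfps_nth f m) \<longrightarrow> g \<in> S \<inter> T)"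
      by (meson finite_Un)
  qed
next
  fix K :: "'a mfps set set"
  assume K: "\<forall>S\<in>K. open S"
  show "open (\<Union>K)"
    unfolding open_mfps_def
  proof
    fix f assume "f \<in> \<Union>K"
    then obtain S where S: "S \<in> K" "f \<in> S" by blast
    have "open S" using K S(1) by (rule bspec)
    then obtain M where M: "finite M" "\<And>g. (\<forall>m\<in>M. mfps_nth g m = mfps_nth f m) \<Longrightarrow> g \<in> S"
      unfolding open_mfps_def using S(2) by meson
    show "\<exists>M. finite M \<and> (\<forall>g. (\<forall>m\<in>M. mfps_nth g m = mfps_nth f m) \<longrightarrow> g \<in> \<Union>K)"
      by (rule exI[of _ M], rule conjI[OF M(1)], intro allI impI UnionI[OF S(1)] M(2))
  qed
qed

end

lemma open_mfps_coeff: "open {g. mfps_nth g m = c}"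
  unfolding open_mfps_def by (auto intro!: exI[of _ "{m}"])

instance mfps :: (type) t2_space
proof
  fix f g :: "'a mfps"
  assume "f \<noteq> g"
  then obtain m where "mfps_nth f m \<noteq> mfps_nth g m" by (auto simp: mfps_eq_iff)
  then show "\<exists>U V. open U \<and> open V \<and> f \<in> U \<and> g \<in> V \<and> U \<inter> V = {}"
    by (intro exI[of _ "{h. mfps_nth h m = mfps_nth f m}"]
              exI[of _ "{h. mfps_nth h m = mfps_nth g m}"] conjI open_mfps_coeff) auto
qed

lemma has_sum_mfps_iff:
  fixes F :: "'b \<Rightarrow> 'a :: comm_ring_1 mfps"
  shows "(F has_sum S) A \<longleftrightarrow>
    (\<forall>m. finite {l\<in>A. mfps_nth (F l) m \<noteq> 0} \<and>
         mfps_nth S m = (\<Sum>l\<in>{l\<in>A. mfps_nth (F l) m \<noteq> 0}. mfps_nth (F l) m))"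
proof -
  have nth_sum: "mfps_nth (sum F B) m = (\<Sum>l\<in>B. mfps_nth (F l) m)" for B m
    by (induction B rule: infinite_finite_induct) auto
  show ?thesis
  proof (intro iffI allI)
    fix m assume "(F has_sum S) A"
    then have "eventually (\<lambda>B. sum F B \<in> {g. mfps_nth g m = mfps_nth S m})
        (finite_subsets_at_top A)"
      unfolding has_sum_def by (rule topological_tendstoD) (auto simp: open_mfps_coeff)
    then obtain B where B: "finite B" "B \<subseteq> A"
      "\<And>C. finite C \<Longrightarrow> B \<subseteq> C \<Longrightarrow> C \<subseteq> A \<Longrightarrow> (\<Sum>l\<in>C. mfps_nth (F l) m) = mfps_nth S m"
      unfolding eventually_finite_subsets_at_top by (auto simp: nth_sum)
    have "mfps_nth (F l) m = 0" if "l \<in> A - B" for l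
      using B(3)[of "insert l B"] B(3)[of B] B(1,2) that by auto
    then have sub: "{l\<in>A. mfps_nth (F l) m \<noteq> 0} \<subseteq> B" by auto
    moreover have "(\<Sum>l\<in>{l\<in>A. mfps_nth (F l) m \<noteq> 0}. mfps_nth (F l) m) = (\<Sum>l\<in>B. mfps_nth (F l) m)"
      by (rule sum.mono_neutral_left) (use B sub in auto)
    ultimately show "finite {l\<in>A. mfps_nth (F l) m \<noteq> 0} \<and>
         mfps_nth S m = (\<Sum>l\<in>{l\<in>A. mfps_nth (F l) m \<noteq> 0}. mfps_nth (F l) m)"
      using B finite_subset by auto
  next
    assume *: "\<forall>m. finite {l\<in>A. mfps_nth (F l) m \<noteq> 0} \<and>
         mfps_nth S m = (\<Sum>l\<in>{l\<in>A. mfps_nth (F l) m \<noteq> 0}. mfps_nth (F l) m)"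
    show "(F has_sum S) A"
      unfolding has_sum_def
    proof (rule topological_tendstoI)
      fix U :: "'a mfps set" assume "open U" "S \<in> U"
      then obtain M where M: "finite M" "\<And>g. (\<forall>m\<in>M. mfps_nth g m = mfps_nth S m) \<Longrightarrow> g \<in> U"
        unfolding open_mfps_def by blast
      let ?B = "\<Union>m\<in>M. {l\<in>A. mfps_nth (F l) m \<noteq> 0}"
      have "sum F C \<in> U" if C: "finite C" "?B \<subseteq> C" "C \<subseteq> A" for C
      proof (rule M(2), rule ballI)
        fix m assume "m \<in> M"
        have "(\<Sum>l\<in>C. mfps_nth (F l) m) = (\<Sum>l\<in>{l\<in>A. mfps_nth (F l) m \<noteq> 0}. mfps_nth (F l) m)"
          by (rule sum.mono_neutral_right) (use C \<open>m \<in> M\<close> in auto)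
        then show "mfps_nth (sum F C) m = mfps_nth S m" using * by (simp add: nth_sum)
      qed
      moreover have "finite ?B" "?B \<subseteq> A" using M(1) * by auto
      ultimately show "eventually (\<lambda>B. sum F B \<in> U) (finite_subsets_at_top A)"
        unfolding eventually_finite_subsets_at_top by blast
    qed
  qed
qed

lift_definition mfps_const :: "'a :: zero \<Rightarrow> 'a mfps" is "\<lambda>c m. if m = 0 then c else 0" .

lift_definition mfps_var :: "nat \<Rightarrow> 'a :: zero_neq_one mfps"
  is "\<lambda>i m. if m = Poly_Mapping.single i 1 then 1 else 0" .

text \<open>The coefficient ring is the polynomial ring in \<open>t\<close>, so that \<open>t\<close> is a constant series.\<close>

definition mfps_t :: "'a :: comm_ring_1 poly mfps" where
  "mfps_t = mfps_const [:0, 1:]"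

text \<open>The indeterminates as elements of the field of fractions of the ring of power series.\<close>

abbreviation fx :: "nat \<Rightarrow> 'a :: idom poly mfps fract" where
  "fx i \<equiv> to_fract (mfps_var i)"

abbreviation ft :: "'a :: idom poly mfps fract" where
  "ft \<equiv> to_fract mfps_t"


section \<open>Partitions\<close>

definition is_partition :: "nat list \<Rightarrow> bool" where
  "is_partition l \<longleftrightarrow> sorted_wrt (\<ge>) l \<and> 0 \<notin> set l"

text \<open>Parts are numbered from 1 and padded with zeros.\<close>

definition part :: "nat list \<Rightarrow> nat \<Rightarrow> nat" where
  "part l i = (if 1 \<le> i \<and> i \<le> length l then l ! (i - 1) else 0)"

text \<open>The \<open>j\<close>-th part of the conjugate is the length of the \<open>j\<close>-th column of the diagram.\<close>

definition conjugate_partition :: "nat list \<Rightarrow> nat list" where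
  "conjugate_partition l = map (\<lambda>j. card {i \<in> {1..length l}. j \<le> part l i}) [1..<part l 1 + 1]"

definition even_parts :: "nat list \<Rightarrow> bool" where
  "even_parts l \<longleftrightarrow> (\<forall>k\<in>set l. even k)"


section \<open>Schur polynomials and Pfaffians\<close>

text \<open>The matrix library indexes rows and columns from 0, hence the shifts. The subtraction in the
  exponent is never truncated.\<close>

definition schur :: "nat \<Rightarrow> nat list \<Rightarrow> 'a :: idom mfps" where
  "schur N l =
     det (mat N N (\<lambda>(i, j). mfps_var (i + 1) ^ (part l (j + 1) + N - (j + 1)))) div
     (\<Prod>(i, j)\<in>{(i, j). 1 \<le> i \<and> i < j \<and> j \<le> N}. mfps_var i - mfps_var j)"

text \<open>The Pfaffian of the antisymmetric \<open>2n \<times> 2n\<close> matrix with entries \<open>a i j\<close> for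
  \<open>1 \<le> i < j \<le> 2n\<close>: the signed sum over all perfect matchings of \<open>{1..2n}\<close>, each written uniquely
  as \<open>{p 1, p 2}, {p 3, p 4}, \<dots>\<close> with \<open>p (2k - 1) < p (2k)\<close> and \<open>p 1 < p 3 < \<dots>\<close>.\<close>

definition pfaffian :: "nat \<Rightarrow> (nat \<Rightarrow> nat \<Rightarrow> 'a) \<Rightarrow> 'a :: comm_ring_1" where
  "pfaffian n a =
     (\<Sum>p | p permutes {1..2*n} \<and> (\<forall>k\<in>{1..n}. p (2*k - 1) < p (2*k)) \<and>
            (\<forall>k\<in>{1..<n}. p (2*k - 1) < p (2*k + 1)).
        of_int (sign p) * (\<Prod>k\<in>{1..n}. a (p (2*k - 1)) (p (2*k))))"

end

theory Submission
  imports Defs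
begin

text \<open>Expanding \<open>(1 - t) / ((1 - u) (1 - t u)) = \<Sum>m. (1 - t^(m+1)) u^m\<close> with \<open>u = x\<^sub>i x\<^sub>j\<close>, the
  Pfaffian becomes a sum over exponents \<open>m\<^sub>1, \<dots>, m\<^sub>n\<close>, one for each block of a perfect matching. Sorting
  the blocks by their exponents instead of by their elements, the terms with two equal exponents
  cancel, and the rest is the sum over \<open>m\<^sub>1 > \<dots> > m\<^sub>n\<close> of
  \<open>\<Prod>k. (1 - t^(m\<^sub>k + 1))\<close> times the alternant with exponents
  \<open>m\<^sub>1 + 1, m\<^sub>1, \<dots>, m\<^sub>n + 1, m\<^sub>n\<close>. The alternants with distinct exponents are those
  of the partitions with \<open>\<lambda>\<^sub>2\<^sub>k\<^sub>-\<^sub>1 = \<lambda>\<^sub>2\<^sub>k = m\<^sub>k - 2n + 2k\<close>. All identities between power series are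
  checked modulo every total degree, where the sums are finite.\<close>

section \<open>Expansion of Pfaffians\<close>

text \<open>The factors 1/(x_i - x_j) are not power series. The identity proved in the ring of
  series is therefore the one multiplied by the Vandermonde product, where every Schur polynomial
  turns into its alternant; the quotient is taken once, at the end, in the field of fractions.
  Summability must still be shown for the Schur polynomials themselves. The Vandermonde product is
  homogeneous of some degree d, so if its product with a series vanishes below degree d + D, that
  series vanishes below degree D. This is the origin of the cutoff d + D in the last part.

  The coefficients may have any characteristic, so averaging over the orders or the orientations of
  the blocks is excluded. Instead each entry is written as \<open>W i j - W j i\<close>, which sums
  over both orientations of a block, and the blocks are identified by their minima, which do not
  depend on the orientation. Passing from this normal form to the one sorted by exponents is a
  bijection between two fundamental domains.\<close>

lemma strict_mono_on_consecutive_iff: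
  fixes f :: "nat \<Rightarrow> 'a :: preorder"
  shows "strict_mono_on {1..n} f \<longleftrightarrow> (\<forall>k\<in>{1..<n}. f k < f (k + 1))"
proof
  assume *: "\<forall>k\<in>{1..<n}. f k < f (k + 1)"
  have "f i < f j" if "1 \<le> i" "i < j" "j \<le> n" for i j
    using that(2,3)
  proof (induction j)
    case (Suc j)
    have step: "f j < f (Suc j)" if "1 \<le> j" using * Suc.prems that by auto
    show ?case
    proof (cases "i = j")
      case False
      then have "f i < f j" using Suc by auto
      then show ?thesis using step False Suc.prems by (auto intro: less_trans)
    qed (use step \<open>1 \<le> i\<close> in auto)
  qed auto
  then show "strict_mono_on {1..n} f" by (auto simp: strict_mono_on_def)
qed (auto simp: strict_mono_on_def)

lemma prod_pairs:
  fixes f :: "nat \<Rightarrow> 'a :: comm_monoid_mult"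
  shows "(\<Prod>j\<in>{1..2*n}. f j) = (\<Prod>k\<in>{1..n}. f (2*k - 1) * f (2*k))"
  by (induction n) (auto simp: mult_ac)

lemma sum_split_conditions:
  assumes "finite A" and PQ: "\<And>x. x \<in> A \<Longrightarrow> P x \<longleftrightarrow> \<not> Q x"
  shows "sum f A = sum f {x \<in> A. P x} + sum f {x \<in> A. Q x}"
proof -
  have "A = {x \<in> A. P x} \<union> {x \<in> A. Q x}" "{x \<in> A. P x} \<inter> {x \<in> A. Q x} = {}"
    using PQ by blast+
  then show ?thesis
    using assms(1) sum.union_disjoint[of "{x \<in> A. P x}" "{x \<in> A. Q x}" f] by simp
qed

text \<open>Composition with the transposition is an involution without fixed points that negates
  \<open>f\<close>. The terms are paired according to whether \<open>q a < q b\<close>, because a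
  sum that merely equals its own negative need not vanish in characteristic 2.\<close>

lemma sum_permutes_eq_0:
  fixes f :: "(nat \<Rightarrow> nat) \<Rightarrow> 'a :: comm_ring_1"
  assumes "finite A" "a \<in> A" "b \<in> A" "a \<noteq> b"
    and R: "\<And>q. q permutes A \<Longrightarrow> R (q \<circ> transpose a b) = R q"
    and f: "\<And>q. q permutes A \<Longrightarrow> R q \<Longrightarrow> f (q \<circ> transpose a b) = - f q"
  shows "(\<Sum>q | q permutes A \<and> R q. f q) = 0"
proof -
  let ?s = "\<lambda>q :: nat \<Rightarrow> nat. q \<circ> transpose a b"
  let ?S = "{q. q permutes A \<and> R q}"
  have fin: "finite ?S"
    by (rule finite_subset[OF _ finite_permutations[OF \<open>finite A\<close>]]) auto
  have ss: "?s (?s q) = q" for q by (simp add: comp_assoc)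
  have ps: "?s q permutes A" if "q permutes A" for q
    using that assms by (intro permutes_compose permutes_swap_id)
  have ne: "q a \<noteq> q b" if "q permutes A" for q
    using that assms(4) permutes_inj by (metis injD)
  have "(\<Sum>q\<in>?S. f q) = (\<Sum>q\<in>{q\<in>?S. q a < q b}. f q) + (\<Sum>q\<in>{q\<in>?S. q b < q a}. f q)"
    by (rule sum_split_conditions[OF fin], drule CollectD, drule conjunct1, drule ne) linarith
  also have "(\<Sum>q\<in>{q\<in>?S. q b < q a}. f q) = (\<Sum>q\<in>{q\<in>?S. q a < q b}. - f q)"
    by (rule sum.reindex_bij_witness[of _ ?s ?s]) (auto simp: ss ps R simp flip: f)
  finally show ?thesis by (simp add: sum_negf)
qed

section \<open>Orientation of the blocks of a matching\<close>

lemma pair_indices_distinct: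
  fixes j k :: nat
  assumes "1 \<le> j" "1 \<le> k" "j \<noteq> k"
  shows "2*j - 1 \<noteq> 2*k - 1" "2*j - 1 \<noteq> 2*k" "2*j \<noteq> 2*k - 1" "2*j \<noteq> 2*k"
  using assms by presburger+

text \<open>Induction on the set \<open>K\<close> of oriented blocks. Exchanging
  \<open>q (2*k - 1)\<close> and \<open>q (2*k)\<close> flips the sign, so the subtracted half of
  the factor of block \<open>k\<close> becomes the term of \<open>W\<close> for the opposite
  orientation, and the constraint on this block disappears.\<close>

lemma sum_orient_pairs:
  fixes W :: "nat \<Rightarrow> nat \<Rightarrow> 'a :: comm_ring_1"
  assumes P: "\<And>q k. k \<in> {1..n} \<Longrightarrow> P (q \<circ> transpose (2*k - 1) (2*k)) = P q"
    and "finite K" "K \<subseteq> {1..n}"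
  shows "(\<Sum>q | q permutes {1..2*n} \<and> P q \<and> (\<forall>k\<in>K. q (2*k - 1) < q (2*k)).
      of_int (sign q) * ((\<Prod>k\<in>K. W (q (2*k - 1)) (q (2*k)) - W (q (2*k)) (q (2*k - 1))) *
        (\<Prod>k\<in>{1..n} - K. W (q (2*k - 1)) (q (2*k))))) =
    (\<Sum>q | q permutes {1..2*n} \<and> P q.
      of_int (sign q) * (\<Prod>k\<in>{1..n}. W (q (2*k - 1)) (q (2*k))))"
  using assms(2,3)
proof (induction K rule: finite_induct)
  case (insert k K)
  let ?V = "\<lambda>q k. W (q (2*k - 1)) (q (2*k))"
  let ?D = "\<lambda>q k. W (q (2*k - 1)) (q (2*k)) - W (q (2*k)) (q (2*k - 1))"
  define Rest where "Rest q = (\<Prod>k\<in>K. ?D q k) * (\<Prod>k\<in>{1..n} - insert k K. ?V q k)" for q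
  let ?s = "\<lambda>q :: nat \<Rightarrow> nat. q \<circ> transpose (2*k - 1) (2*k)"
  let ?T = "{q. q permutes {1..2*n} \<and> P q \<and> (\<forall>k\<in>K. q (2*k - 1) < q (2*k))}"
  have k: "k \<in> {1..n}" "k \<notin> K" using insert by auto
  have fin: "finite ?T"
    by (rule finite_subset[OF _ finite_permutations[of "{1..2*n}"]]) auto
  have ss: "?s (?s q) = q" for q by (simp add: comp_assoc)
  have ps: "?s q permutes {1..2*n}" if "q permutes {1..2*n}" for q
    using that k by (intro permutes_compose permutes_swap_id) auto
  have sgn: "sign (?s q) = - sign q" if "q permutes {1..2*n}" for q
  proof -
    have "permutation q" using that permutation_permutes by blast
    then show ?thesis using k by (auto simp: sign_compose permutation_swap_id sign_swap_id)
  qed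
  have at_k: "?s q (2*k - 1) = q (2*k)" "?s q (2*k) = q (2*k - 1)" for q
    by simp_all
  have other: "?s q (2*j - 1) = q (2*j - 1)" "?s q (2*j) = q (2*j)" if "j \<in> {1..n}" "j \<noteq> k" for q j
  proof -
    have "2*j - 1 \<noteq> 2*k - 1" "2*j - 1 \<noteq> 2*k" "2*j \<noteq> 2*k - 1" "2*j \<noteq> 2*k"
      using pair_indices_distinct[of j k] that k by auto
    then show "?s q (2*j - 1) = q (2*j - 1)" "?s q (2*j) = q (2*j)"
      by (simp_all add: transpose_def)
  qed
  have Rest: "Rest (?s q) = Rest q" for q
  proof -
    have V: "?V (?s q) j = ?V q j" if "j \<in> {1..n}" "j \<noteq> k" for j
      by (simp only: other[OF that])
    have D: "?D (?s q) j = ?D q j" if "j \<in> {1..n}" "j \<noteq> k" for j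
      by (simp only: other[OF that])
    have "(\<Prod>j\<in>K. ?D (?s q) j) = (\<Prod>j\<in>K. ?D q j)"
      by (rule prod.cong[OF refl], rule D) (use insert.prems k in auto)
    moreover have "(\<Prod>j\<in>{1..n} - insert k K. ?V (?s q) j) = (\<Prod>j\<in>{1..n} - insert k K. ?V q j)"
      by (rule prod.cong[OF refl], rule V) auto
    ultimately show ?thesis unfolding Rest_def by simp
  qed
  have sT: "?s q \<in> ?T" if "q \<in> ?T" for q
  proof -
    have "\<forall>j\<in>K. ?s q (2*j - 1) < ?s q (2*j)"
    proof
      fix j assume "j \<in> K"
      then have "j \<in> {1..n}" "j \<noteq> k" using insert k by auto
      then show "?s q (2*j - 1) < ?s q (2*j)" using other that \<open>j \<in> K\<close> by auto
    qed
    then show ?thesis using that ps P[OF k(1)] by auto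
  qed
  have ne: "q (2*k - 1) \<noteq> q (2*k)" if "q \<in> ?T" for q
  proof -
    have "inj q" using that permutes_inj by blast
    moreover have "2*k - 1 \<noteq> 2*k" using k by auto
    ultimately show ?thesis by (auto dest: injD)
  qed
  let ?L = "{q\<in>?T. q (2*k - 1) < q (2*k)}"
  let ?G = "{q\<in>?T. q (2*k) < q (2*k - 1)}"
  have "(\<Sum>q | q permutes {1..2*n} \<and> P q \<and> (\<forall>k\<in>insert k K. q (2*k - 1) < q (2*k)).
      of_int (sign q) * ((\<Prod>k\<in>insert k K. ?D q k) * (\<Prod>k\<in>{1..n} - insert k K. ?V q k)))
    = (\<Sum>q\<in>?L. of_int (sign q) * (?D q k * Rest q))"
  proof (rule sum.cong)
    show "{q. q permutes {1..2*n} \<and> P q \<and> (\<forall>k\<in>insert k K. q (2*k - 1) < q (2*k))} = ?L"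
      by blast
    show "of_int (sign q) * ((\<Prod>k\<in>insert k K. ?D q k) * (\<Prod>k\<in>{1..n} - insert k K. ?V q k)) =
        of_int (sign q) * (?D q k * Rest q)" for q
      unfolding Rest_def prod.insert[OF insert.hyps] by (simp only: mult.assoc)
  qed
  also have "\<dots> = (\<Sum>q\<in>?L. of_int (sign q) * (?V q k * Rest q)) +
      (\<Sum>q\<in>?L. - (of_int (sign q) * (W (q (2*k)) (q (2*k - 1)) * Rest q)))"
    unfolding sum.distrib[symmetric] by (intro sum.cong refl) (simp add: algebra_simps)
  also have "(\<Sum>q\<in>?L. - (of_int (sign q) * (W (q (2*k)) (q (2*k - 1)) * Rest q))) =
      (\<Sum>q\<in>?G. of_int (sign q) * (?V q k * Rest q))"
  proof -
    have 1: "?s q \<in> ?G" if "q \<in> ?L" for q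
      using that sT[of q] by (simp add: at_k)
    have 2: "?s q \<in> ?L" if "q \<in> ?G" for q
      using that sT[of q] by (simp add: at_k)
    have 3: "of_int (sign (?s q)) * (?V (?s q) k * Rest (?s q)) =
        - (of_int (sign q) * (W (q (2*k)) (q (2*k - 1)) * Rest q))" if "q \<in> ?L" for q
    proof -
      have "sign (?s q) = - sign q" using that by (intro sgn) blast
      then show ?thesis unfolding Rest at_k by simp
    qed
    show ?thesis
      by (rule sum.reindex_bij_witness[of ?L ?s ?s ?G]; (rule ss | erule 1 | erule 2 | erule 3))
  qed
  also have "(\<Sum>q\<in>?L. of_int (sign q) * (?V q k * Rest q)) + \<dots> =
      (\<Sum>q\<in>?T. of_int (sign q) * (?V q k * Rest q))"
    by (rule sum_split_conditions[OF fin, symmetric], drule ne) linarith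
  also have "\<dots> = (\<Sum>q\<in>?T. of_int (sign q) * ((\<Prod>k\<in>K. ?D q k) * (\<Prod>k\<in>{1..n} - K. ?V q k)))"
  proof (intro sum.cong refl)
    fix q
    have eq: "{1..n} - K = insert k ({1..n} - insert k K)" using k by auto
    have "(\<Prod>k\<in>{1..n} - K. ?V q k) = ?V q k * (\<Prod>k\<in>{1..n} - insert k K. ?V q k)"
      unfolding eq by (rule prod.insert) auto
    then show "of_int (sign q) * (?V q k * Rest q) =
        of_int (sign q) * ((\<Prod>k\<in>K. ?D q k) * (\<Prod>k\<in>{1..n} - K. ?V q k))"
      unfolding Rest_def by (simp only: mult_ac)
  qed
  also have "\<dots> = (\<Sum>q | q permutes {1..2*n} \<and> P q.
      of_int (sign q) * (\<Prod>k\<in>{1..n}. ?V q k))"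
    by (rule insert.IH) (use insert.prems in simp)
  finally show ?case .
qed simp

text \<open>For oriented blocks this is the condition \<open>p 1 < p 3 < \<dots>\<close> of the
  Pfaffian. The minimum makes it invariant under exchanges inside a block, as
  \<open>sum_orient_pairs\<close> demands of \<open>P\<close>.\<close>

definition min_ordered :: "nat \<Rightarrow> (nat \<Rightarrow> nat) \<Rightarrow> bool" where
  "min_ordered n q \<longleftrightarrow> strict_mono_on {1..n} (\<lambda>k. min (q (2*k - 1)) (q (2*k)))"

lemma pfaffian_skew:
  fixes W :: "nat \<Rightarrow> nat \<Rightarrow> 'a :: comm_ring_1"
  shows "pfaffian n (\<lambda>i j. W i j - W j i) =
    (\<Sum>q | q permutes {1..2*n} \<and> min_ordered n q.
      of_int (sign q) * (\<Prod>k\<in>{1..n}. W (q (2*k - 1)) (q (2*k))))"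
proof -
  have min_swap: "min_ordered n (q \<circ> transpose (2*k - 1) (2*k)) = min_ordered n q"
    if "k \<in> {1..n}" for q k
  proof -
    let ?s = "q \<circ> transpose (2*k - 1) (2*k)"
    have eq: "min (?s (2*j - 1)) (?s (2*j)) = min (q (2*j - 1)) (q (2*j))" if "j \<in> {1..n}" for j
    proof (cases "j = k")
      case False
      then have "2*j - 1 \<noteq> 2*k - 1" "2*j - 1 \<noteq> 2*k" "2*j \<noteq> 2*k - 1" "2*j \<noteq> 2*k"
        using pair_indices_distinct[of j k] that \<open>k \<in> {1..n}\<close> by auto
      then show ?thesis by (simp add: transpose_def)
    qed (auto simp: transpose_def min.commute)
    show ?thesis
      unfolding min_ordered_def strict_mono_on_def using eq by simp
  qed
  \<comment> \<open>The empty product over \<open>{1..n} - {1..n}\<close> brings the sum into the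
    shape of \<open>sum_orient_pairs\<close> with all blocks oriented.\<close>
  have "pfaffian n (\<lambda>i j. W i j - W j i) =
    (\<Sum>q | q permutes {1..2*n} \<and> min_ordered n q \<and> (\<forall>k\<in>{1..n}. q (2*k - 1) < q (2*k)).
      of_int (sign q) * ((\<Prod>k\<in>{1..n}. W (q (2*k - 1)) (q (2*k)) - W (q (2*k)) (q (2*k - 1))) *
        (\<Prod>k\<in>{1..n} - {1..n}. W (q (2*k - 1)) (q (2*k)))))"
    unfolding pfaffian_def
  proof (rule sum.cong)
    have "(\<forall>k\<in>{1..<n}. p (2*k - 1) < p (2*k + 1)) \<longleftrightarrow> min_ordered n p"
      if *: "\<forall>k\<in>{1..n}. p (2*k - 1) < p (2*k)" for p :: "nat \<Rightarrow> nat"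
    proof -
      have m: "min (p (2*k - 1)) (p (2*k)) = p (2*k - 1)" if "k \<in> {1..n}" for k
        using * that by (simp add: min_def less_imp_le)
      have "min_ordered n p \<longleftrightarrow> strict_mono_on {1..n} (\<lambda>k. p (2*k - 1))"
        unfolding min_ordered_def strict_mono_on_def using m by simp
      then show ?thesis unfolding strict_mono_on_consecutive_iff by simp
    qed
    then show "{p. p permutes {1..2*n} \<and> (\<forall>k\<in>{1..n}. p (2*k - 1) < p (2*k)) \<and>
        (\<forall>k\<in>{1..<n}. p (2*k - 1) < p (2*k + 1))} =
      {q. q permutes {1..2*n} \<and> min_ordered n q \<and> (\<forall>k\<in>{1..n}. q (2*k - 1) < q (2*k))}"
      by blast
  qed simp
  also have "\<dots> = (\<Sum>q | q permutes {1..2*n} \<and> min_ordered n q.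
      of_int (sign q) * (\<Prod>k\<in>{1..n}. W (q (2*k - 1)) (q (2*k))))"
    by (rule sum_orient_pairs) (use min_swap in auto)
  finally show ?thesis .
qed

section \<open>Sorted representatives and fundamental domains\<close>

lemma ex_sorting_permutation:
  fixes key :: "nat \<Rightarrow> 'a :: linorder"
  assumes "inj_on key {1..n}"
  obtains g where "g permutes {1..n}" "strict_mono_on {1..n} (key \<circ> g)"
proof -
  let ?A = "{1..n}"
  define xs where "xs = sorted_list_of_set (key ` ?A)"
  have len: "length xs = n"
    using card_image[OF assms] by (simp add: xs_def)
  have set: "set xs = key ` ?A" by (simp add: xs_def)
  have sorted: "sorted_wrt (<) xs" by (simp add: xs_def)
  define g where "g k = (if k \<in> ?A then inv_into ?A key (xs ! (k - 1)) else k)" for k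
  have key_g: "key (g k) = xs ! (k - 1)" "g k \<in> ?A" if "k \<in> ?A" for k
  proof -
    have "xs ! (k - 1) \<in> key ` ?A" using that set len nth_mem[of "k - 1" xs] by auto
    then show "key (g k) = xs ! (k - 1)" "g k \<in> ?A"
      using that by (auto simp: g_def f_inv_into_f inv_into_into simp del: atLeastAtMost_iff)
  qed
  have mono: "strict_mono_on ?A (key \<circ> g)"
  proof (rule strict_mono_onI)
    fix i j assume "i \<in> ?A" "j \<in> ?A" "i < j"
    then have "xs ! (i - 1) < xs ! (j - 1)"
      using len by (intro sorted_wrt_nth_less[OF sorted]) auto
    then show "(key \<circ> g) i < (key \<circ> g) j"
      using key_g(1)[OF \<open>i \<in> ?A\<close>] key_g(1)[OF \<open>j \<in> ?A\<close>] by simp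
  qed
  have "inj_on g ?A"
    using strict_mono_on_imp_inj_on[OF mono] by (rule inj_on_imageI2)
  then have "bij_betw g ?A ?A"
    using key_g(2) by (intro bij_betw_imageI endo_inj_surj) auto
  then have "g permutes ?A"
    by (rule bij_imp_permutes) (auto simp: g_def)
  with mono that show thesis by blast
qed

text \<open>Since \<open>key\<close> and \<open>key \<circ> p\<close> both increase, so does
  \<open>p\<close>; then \<open>i \<le> p i\<close> throughout, which only the identity satisfies.
  This gives uniqueness of the sorted representative in an orbit.\<close>

lemma sorting_permutation_id:
  fixes key :: "nat \<Rightarrow> 'a :: linorder"
  assumes key: "strict_mono_on {1..n} key" and p: "p permutes {1..n}"
    and key_p: "strict_mono_on {1..n} (key \<circ> p)"
  shows "p = id"
proof -
  have mono: "p i < p j" if "i \<in> {1..n}" "j \<in> {1..n}" "i < j" for i j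
  proof (rule ccontr)
    assume "\<not> p i < p j"
    then have "p j \<le> p i" by simp
    moreover have "p i \<in> {1..n}" "p j \<in> {1..n}" using permutes_in_image[OF p] that by blast+
    ultimately have "key (p j) \<le> key (p i)"
      using strict_mono_on_imp_mono_on[OF key] by (auto simp: monotone_on_def)
    moreover have "key (p i) < key (p j)"
      using strict_mono_onD[OF key_p that] by simp
    ultimately show False by simp
  qed
  have "i \<le> p i" if "i \<in> {1..n}" for i
    using that
  proof (induction i)
    case (Suc i)
    then show ?case
      using mono[of i "Suc i"] permutes_in_seg[OF p Suc.prems] by (cases "i = 0") auto
  qed simp
  then show ?thesis using permutes_natset_ge[OF p] by blast
qed

text \<open>Two fundamental domains of the symmetric group acting on \<open>X\<close>, each cut out by requiring some
  injective key to be sorted, yield the same sum of an invariant function. No division by the order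
  of the group is needed, so this holds in every characteristic.\<close>

lemma sum_sorted_transversals:
  fixes key1 key2 :: "'x \<Rightarrow> nat \<Rightarrow> 'b :: linorder"
    and act :: "'x \<Rightarrow> (nat \<Rightarrow> nat) \<Rightarrow> 'x"
  assumes act_X: "\<And>x g. x \<in> X \<Longrightarrow> g permutes {1..n} \<Longrightarrow> act x g \<in> X"
    and act_comp: "\<And>x g h. x \<in> X \<Longrightarrow> g permutes {1..n} \<Longrightarrow> h permutes {1..n} \<Longrightarrow>
                     act (act x g) h = act x (g \<circ> h)"
    and act_id: "\<And>x. x \<in> X \<Longrightarrow> act x id = x"
    and key1: "\<And>x g k. x \<in> X \<Longrightarrow> g permutes {1..n} \<Longrightarrow> k \<in> {1..n} \<Longrightarrow> key1 (act x g) k = key1 x (g k)"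
    and key2: "\<And>x g k. x \<in> X \<Longrightarrow> g permutes {1..n} \<Longrightarrow> k \<in> {1..n} \<Longrightarrow> key2 (act x g) k = key2 x (g k)"
    and inj1: "\<And>x. x \<in> X \<Longrightarrow> inj_on (key1 x) {1..n}"
    and inj2: "\<And>x. x \<in> X \<Longrightarrow> inj_on (key2 x) {1..n}"
    and F: "\<And>x g. x \<in> X \<Longrightarrow> g permutes {1..n} \<Longrightarrow> F (act x g) = F x"
  shows "sum F {x \<in> X. strict_mono_on {1..n} (key1 x)} = sum F {x \<in> X. strict_mono_on {1..n} (key2 x)}"
proof -
  define srt :: "(nat \<Rightarrow> 'b) \<Rightarrow> nat \<Rightarrow> nat" where
    "srt f = (SOME g. g permutes {1..n} \<and> strict_mono_on {1..n} (f \<circ> g))" for f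
  have srt: "srt f permutes {1..n}" "strict_mono_on {1..n} (f \<circ> srt f)"
    if "inj_on (f) {1..n}" for f
  proof -
    have "\<exists>g. g permutes {1..n} \<and> strict_mono_on {1..n} (f \<circ> g)"
      using ex_sorting_permutation[OF that] by metis
    from someI_ex[OF this]
    show "srt f permutes {1..n}" "strict_mono_on {1..n} (f \<circ> srt f)"
      by (simp_all add: srt_def)
  qed
  have sorted: "strict_mono_on {1..n} (key (act x (srt (key x))))"
    if "inj_on (key x) {1..n}"
      and key: "\<And>g k. g permutes {1..n} \<Longrightarrow> k \<in> {1..n} \<Longrightarrow> key (act x g) k = key x (g k)" for key x
    using srt[OF that(1)] key[OF srt(1)[OF that(1)]]
    by (simp add: strict_mono_on_def)
  \<comment> \<open>Let \<open>g\<close> sort \<open>key'\<close>, and let \<open>h\<close> then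
    sort \<open>key\<close> again. Then \<open>g \<circ> h\<close> sorts the values of
    \<open>key\<close> at \<open>x\<close>, which are sorted already, so it is the identity. Hence
    sorting by one key and sorting by the other are mutually inverse on the two domains.\<close>
  have inverse_act: "act (act x (srt (key' x))) (srt (key (act x (srt (key' x))))) = x"
    if x: "x \<in> X" and s: "strict_mono_on {1..n} (key x)"
      and inj': "inj_on (key' x) {1..n}"
      and inj: "\<And>x. x \<in> X \<Longrightarrow> inj_on (key x) {1..n}"
      and key: "\<And>x g k. x \<in> X \<Longrightarrow> g permutes {1..n} \<Longrightarrow> k \<in> {1..n} \<Longrightarrow> key (act x g) k = key x (g k)"
    for key key' x
  proof -
    define g where "g = srt (key' x)"
    define h where "h = srt (key (act x g))"
    have g: "g permutes {1..n}" unfolding g_def by (rule srt(1)[OF inj'])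
    have xg: "act x g \<in> X" by (rule act_X[OF x g])
    have h: "h permutes {1..n}" unfolding h_def by (rule srt(1)[OF inj[OF xg]])
    have gh: "g \<circ> h permutes {1..n}" by (rule permutes_compose[OF h g])
    have "strict_mono_on {1..n} (key (act (act x g) h))"
      unfolding h_def by (rule sorted[where key = key, OF inj[OF xg] key[OF xg]])
    then have "strict_mono_on {1..n} (key x \<circ> (g \<circ> h))"
      unfolding act_comp[OF x g h] using key[OF x gh] by (simp add: strict_mono_on_def)
    then have "g \<circ> h = id" by (rule sorting_permutation_id[OF s gh])
    then have "act (act x g) h = x" using act_comp[OF x g h] act_id[OF x] by simp
    then show ?thesis unfolding h_def g_def .
  qed
  show ?thesis
  proof (rule sum.reindex_bij_witness[of _ "\<lambda>x. act x (srt (key1 x))" "\<lambda>x. act x (srt (key2 x))"])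
    fix x assume x: "x \<in> {x \<in> X. strict_mono_on {1..n} (key1 x)}"
    then have xX: "x \<in> X" and s: "strict_mono_on {1..n} (key1 x)" by auto
    show "act (act x (srt (key2 x))) (srt (key1 (act x (srt (key2 x))))) = x"
      by (rule inverse_act[where key = key1 and key' = key2, OF xX s inj2[OF xX] inj1 key1])
    show "act x (srt (key2 x)) \<in> {x \<in> X. strict_mono_on {1..n} (key2 x)}"
      using sorted[where key = key2, OF inj2[OF xX] key2[OF xX]]
        act_X[OF xX srt(1)[OF inj2[OF xX]]] by blast
    show "F (act x (srt (key2 x))) = F x"
      by (rule F[OF xX srt(1)[OF inj2[OF xX]]])
  next
    fix x assume x: "x \<in> {x \<in> X. strict_mono_on {1..n} (key2 x)}"
    then have xX: "x \<in> X" and s: "strict_mono_on {1..n} (key2 x)" by auto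
    show "act (act x (srt (key1 x))) (srt (key2 (act x (srt (key1 x))))) = x"
      by (rule inverse_act[where key = key2 and key' = key1, OF xX s inj1[OF xX] inj2 key2])
    show "act x (srt (key1 x)) \<in> {x \<in> X. strict_mono_on {1..n} (key1 x)}"
      using sorted[where key = key1, OF inj1[OF xX] key1[OF xX]]
        act_X[OF xX srt(1)[OF inj1[OF xX]]] by blast
  qed
qed

section \<open>Permutations of whole blocks\<close>

definition block_perm :: "nat \<Rightarrow> (nat \<Rightarrow> nat) \<Rightarrow> nat \<Rightarrow> nat" where
  "block_perm n g =
     map_permutation {1..n} (\<lambda>k. 2*k) g \<circ> map_permutation {1..n} (\<lambda>k. 2*k - 1) g"

lemma inj_on_double: "inj_on (\<lambda>k. 2*k) {1..n::nat}" "inj_on (\<lambda>k. 2*k - 1) {1..n::nat}"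
  by (auto simp: inj_on_def)

lemma map_permutation_not_in: "j \<notin> f ` A \<Longrightarrow> map_permutation A f g j = j"
  by (simp add: map_permutation_def restrict_id_def)

context
  fixes n :: nat and g :: "nat \<Rightarrow> nat"
  assumes g: "g permutes {1..n}"
begin

lemma block_perm_even:
  assumes "k \<in> {1..n}" shows "block_perm n g (2*k) = 2 * g k"
proof -
  have "2*k \<notin> (\<lambda>k. 2*k - 1) ` {1..n}"
  proof
    assume "2*k \<in> (\<lambda>k. 2*k - 1) ` {1..n}"
    then obtain j where "1 \<le> j" "2*k = 2*j - 1" by auto
    then show False by presburger
  qed
  moreover have "map_permutation {1..n} (\<lambda>k. 2*k) g (2*k) = 2 * g k"
    using map_permutation_apply[OF inj_on_double(1) assms, of g] by simp
  ultimately show ?thesis by (simp add: block_perm_def map_permutation_not_in)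
qed

lemma block_perm_odd:
  assumes "k \<in> {1..n}" shows "block_perm n g (2*k - 1) = 2 * g k - 1"
proof -
  have "1 \<le> g k" using permutes_in_seg[OF g assms] by simp
  moreover have "2 * i - 1 \<noteq> 2 * j" if "1 \<le> i" for i j :: nat using that by presburger
  ultimately have "2 * g k - 1 \<notin> (\<lambda>k. 2*k) ` {1..n}" by blast
  moreover have "map_permutation {1..n} (\<lambda>k. 2*k - 1) g (2*k - 1) = 2 * g k - 1"
    using map_permutation_apply[OF inj_on_double(2) assms, of g] by simp
  ultimately show ?thesis by (simp add: block_perm_def map_permutation_not_in)
qed

lemma block_perm_permutes_aux:
  "map_permutation {1..n} (\<lambda>k. 2*k) g permutes {1..2*n}"
  "map_permutation {1..n} (\<lambda>k. 2*k - 1) g permutes {1..2*n}"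
proof -
  have "map_permutation {1..n} (\<lambda>k. 2*k) g permutes (\<lambda>k. 2*k) ` {1..n}"
    by (rule map_permutation_permutes[OF inj_on_imp_bij_betw[OF inj_on_double(1)] g])
  then show "map_permutation {1..n} (\<lambda>k. 2*k) g permutes {1..2*n}"
    by (rule permutes_subset) auto
  have "map_permutation {1..n} (\<lambda>k. 2*k - 1) g permutes (\<lambda>k. 2*k - 1) ` {1..n}"
    by (rule map_permutation_permutes[OF inj_on_imp_bij_betw[OF inj_on_double(2)] g])
  then show "map_permutation {1..n} (\<lambda>k. 2*k - 1) g permutes {1..2*n}"
    by (rule permutes_subset) auto
qed

lemma block_perm_permutes: "block_perm n g permutes {1..2*n}"
  unfolding block_perm_def by (rule permutes_compose) (rule block_perm_permutes_aux)+

text \<open>One copy of \<open>g\<close> acts on the even indices and one on the odd indices, so the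
  sign is a square. Reordering whole blocks therefore preserves the signed terms of the
  Pfaffian.\<close>

lemma sign_block_perm: "sign (block_perm n g) = 1"
proof -
  have "permutation (map_permutation {1..n} (\<lambda>k. 2*k) g)"
    "permutation (map_permutation {1..n} (\<lambda>k. 2*k - 1) g)"
    using block_perm_permutes_aux permutation_permutes by blast+
  then have "sign (block_perm n g) = sign (map_permutation {1..n} (\<lambda>k. 2*k) g) *
      sign (map_permutation {1..n} (\<lambda>k. 2*k - 1) g)"
    unfolding block_perm_def by (rule sign_compose)
  also have "\<dots> = sign g * sign g"
    unfolding sign_map_permutation[OF inj_on_double(1) g finite_atLeastAtMost]
      sign_map_permutation[OF inj_on_double(2) g finite_atLeastAtMost] ..
  finally show ?thesis by simp
qed

end

lemma pairs_cases:
  assumes "j \<in> {1..2*n::nat}"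
  obtains k where "k \<in> {1..n}" "j = 2*k" | k where "k \<in> {1..n}" "j = 2*k - 1"
proof (cases "even j")
  case True
  then show thesis using that(1)[of "j div 2"] assms by auto
next
  case False
  then obtain i where "j = 2*i + 1" by (rule oddE)
  then show thesis using that(2)[of "i + 1"] assms by auto
qed

lemma block_perm_comp:
  assumes g: "g permutes {1..n}" and h: "h permutes {1..n}"
  shows "block_perm n (g \<circ> h) = block_perm n g \<circ> block_perm n h"
proof
  fix j
  note gh = permutes_compose[OF h g]
  show "block_perm n (g \<circ> h) j = (block_perm n g \<circ> block_perm n h) j"
  proof (cases "j \<in> {1..2*n}")
    case True
    then show ?thesis
    proof (cases rule: pairs_cases)
      case (1 k)
      moreover have "h k \<in> {1..n}" using permutes_in_image[OF h] 1(1) by blast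
      ultimately show ?thesis
        by (simp add: block_perm_even[OF g] block_perm_even[OF h] block_perm_even[OF gh]
              del: atLeastAtMost_iff)
    next
      case (2 k)
      moreover have "h k \<in> {1..n}" using permutes_in_image[OF h] 2(1) by blast
      ultimately show ?thesis
        by (simp add: block_perm_odd[OF g, simplified] block_perm_odd[OF h, simplified]
             block_perm_odd[OF gh, simplified])
    qed
  next
    case False
    then show ?thesis
      using permutes_not_in[OF block_perm_permutes] g h gh by simp
  qed
qed

lemma block_perm_id: "block_perm n id = id"
  using map_permutation_id'[OF inj_on_double(1)] map_permutation_id'[OF inj_on_double(2)]
  by (simp only: block_perm_def comp_id)

section \<open>Alternants\<close>

definition alternant :: "nat \<Rightarrow> (nat \<Rightarrow> nat) \<Rightarrow> (nat \<Rightarrow> 'a) \<Rightarrow> 'a :: comm_ring_1" where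
  "alternant N e x = det (mat N N (\<lambda>(i, j). x (i + 1) ^ e (j + 1)))"

lemma alternant_Leibniz:
  "alternant N e x = (\<Sum>q | q permutes {1..N}. of_int (sign q) * (\<Prod>j\<in>{1..N}. x (q j) ^ e j))"
proof -
  have inj: "inj_on Suc {0..<N}" and bij: "bij_betw Suc {0..<N} {1..N}"
    by (auto intro!: bij_betwI[of _ _ _ "\<lambda>j. j - 1"])
  have bij': "bij_betw (\<lambda>j. j - 1) {1..N} {0..<N}" and inj': "inj_on (\<lambda>j. j - 1) {1..N}"
    by (auto intro!: bij_betwI[of _ _ _ Suc] simp: inj_on_def)
  have "alternant N e x = (\<Sum>p | p permutes {0..<N}.
      of_int (sign p) * (\<Prod>j<N. x (p j + 1) ^ e (j + 1)))"
  proof -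
    have "p j < N" if "p permutes {0..<N}" "j < N" for p j
      using permutes_in_image[OF that(1), of j] that(2) by simp
    then show ?thesis
      unfolding alternant_def by (subst det_col[of _ N]) (auto intro!: sum.cong prod.cong)
  qed
  also have "\<dots> = (\<Sum>q | q permutes {1..N}. of_int (sign q) * (\<Prod>j\<in>{1..N}. x (q j) ^ e j))"
  proof (rule sum.reindex_bij_witness[of _ "map_permutation {1..N} (\<lambda>j. j - 1)"
        "map_permutation {0..<N} Suc"])
    fix p assume "p \<in> {p. p permutes {0..<N}}"
    then have p: "p permutes {0..<N}" by simp
    show "map_permutation {1..N} (\<lambda>j. j - 1) (map_permutation {0..<N} Suc p) = p"
      by (rule map_permutation_compose_inv[OF bij p]) auto
    show "map_permutation {0..<N} Suc p \<in> {q. q permutes {1..N}}"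
      using map_permutation_permutes[OF bij p] by simp
    have "(\<Prod>j<N. x (p j + 1) ^ e (j + 1)) = (\<Prod>j<N. x (map_permutation {0..<N} Suc p (Suc j)) ^ e (Suc j))"
      by (intro prod.cong refl) (simp add: map_permutation_apply[OF inj])
    also have "\<dots> = (\<Prod>j\<in>{1..N}. x (map_permutation {0..<N} Suc p j) ^ e j)"
      by (rule prod.reindex_bij_betw) (use bij in \<open>simp add: lessThan_atLeast0\<close>)
    finally show "of_int (sign (map_permutation {0..<N} Suc p)) *
        (\<Prod>j\<in>{1..N}. x (map_permutation {0..<N} Suc p j) ^ e j) =
        of_int (sign p) * (\<Prod>j<N. x (p j + 1) ^ e (j + 1))"
      by (simp add: sign_map_permutation[OF inj p])
  next
    fix q assume "q \<in> {q. q permutes {1..N}}"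
    then have q: "q permutes {1..N}" by simp
    show "map_permutation {0..<N} Suc (map_permutation {1..N} (\<lambda>j. j - 1) q) = q"
      by (rule map_permutation_compose_inv[OF bij' q]) auto
    show "map_permutation {1..N} (\<lambda>j. j - 1) q \<in> {p. p permutes {0..<N}}"
      using map_permutation_permutes[OF bij' q] by simp
  qed
  finally show ?thesis .
qed

text \<open>The Newton interpolation coefficients \<open>d k\<close> of the monomial of degree \<open>e\<close> are the complete
  homogeneous symmetric polynomials in the first \<open>k + 1\<close> nodes.\<close>

lemma power_Newton:
  fixes y :: "nat \<Rightarrow> 'a :: comm_ring_1"
  shows "\<exists>d. \<forall>i<N. y i ^ e = (\<Sum>k<N. (\<Prod>l<k. y i - y l) * d k)"
proof (induction e)
  case 0
  have "(\<Sum>k<N. (\<Prod>l<k. y i - y l) * (if k = 0 then 1 else 0)) = 1" if "i < N" for i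
    using that by (subst sum.remove[of _ 0]) auto
  then show ?case by (intro exI[of _ "\<lambda>k. if k = 0 then 1 else 0"]) simp
next
  case (Suc e)
  then obtain d where d: "\<And>i. i < N \<Longrightarrow> y i ^ e = (\<Sum>k<N. (\<Prod>l<k. y i - y l) * d k)" by blast
  \<comment> \<open>With \<open>w k = (\<Prod>l<k. y i - y l)\<close> one has
    \<open>y i * w k = y k * w k + w (k + 1)\<close>; comparing coefficients of \<open>w k\<close>
    gives this recursion.\<close>
  define d' where "d' k = y k * d k + (case k of 0 \<Rightarrow> 0 | Suc j \<Rightarrow> d j)" for k
  have "y i ^ Suc e = (\<Sum>k<N. (\<Prod>l<k. y i - y l) * d' k)" if "i < N" for i
  proof -
    let ?w = "\<lambda>k. \<Prod>l<k. y i - y l"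
    \<comment> \<open>The index shift produces a term of index \<open>N\<close>, which dies because
      \<open>y i\<close> is itself one of the nodes.\<close>
    have "?w N = 0" using that by (intro prod_zero) auto
    have "y i ^ Suc e = (\<Sum>k<N. ?w k * (y k * d k)) + (\<Sum>k<N. ?w (Suc k) * d k)"
      using d[OF that] by (simp add: sum_distrib_left algebra_simps flip: sum.distrib)
    also have "(\<Sum>k<N. ?w (Suc k) * d k) = (\<Sum>k<Suc N. ?w k * (case k of 0 \<Rightarrow> 0 | Suc j \<Rightarrow> d j))"
      by (subst sum.lessThan_Suc_shift) simp
    also have "\<dots> = (\<Sum>k<N. ?w k * (case k of 0 \<Rightarrow> 0 | Suc j \<Rightarrow> d j))"
      using \<open>?w N = 0\<close> by simp
    finally show ?thesis by (simp add: d'_def algebra_simps flip: sum.distrib)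
  qed
  then show ?case by blast
qed

definition Vandermonde :: "nat \<Rightarrow> (nat \<Rightarrow> 'a) \<Rightarrow> 'a :: comm_ring_1" where
  "Vandermonde N x = (\<Prod>(i, j)\<in>{(i, j). 1 \<le> i \<and> i < j \<and> j \<le> N}. x i - x j)"

lemma finite_index_pairs: "finite {(i, j). 1 \<le> i \<and> i < j \<and> j \<le> (N::nat)}"
  by (rule finite_subset[of _ "{1..N} \<times> {1..N}"]) auto

text \<open>Newton interpolation factors the matrix of powers as \<open>L * R\<close>, where
  \<open>R\<close> holds the interpolation coefficients and \<open>L\<close> is lower triangular
  with diagonal entries \<open>\<Prod>l<i. y i - y l\<close>. Hence \<open>det L\<close> is the
  Vandermonde product up to sign. The explicit factorization avoids any argument by roots or coprime
  factors.\<close>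

lemma Vandermonde_dvd_alternant:
  fixes x :: "nat \<Rightarrow> 'a :: comm_ring_1"
  shows "Vandermonde N x dvd alternant N e x"
proof -
  define y where "y i = x (i + 1)" for i
  have "\<forall>j. \<exists>d. \<forall>i<N. y i ^ e (j + 1) = (\<Sum>k<N. (\<Prod>l<k. y i - y l) * d k)"
    using power_Newton[of N y] by blast
  then obtain d where d: "\<And>i j. i < N \<Longrightarrow> y i ^ e (j + 1) = (\<Sum>k<N. (\<Prod>l<k. y i - y l) * d j k)"
    by metis
  define L where "L = mat N N (\<lambda>(i, k). \<Prod>l<k. y i - y l)"
  define R where "R = mat N N (\<lambda>(k, j). d j k)"
  have carrier: "L \<in> carrier_mat N N" "R \<in> carrier_mat N N" by (simp_all add: L_def R_def)
  have "mat N N (\<lambda>(i, j). x (i + 1) ^ e (j + 1)) = L * R"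
    using d by (intro eq_matI)
      (auto simp: L_def R_def y_def scalar_prod_def lessThan_atLeast0)
  then have "alternant N e x = det L * det R"
    unfolding alternant_def using det_mult[OF carrier] by simp
  also have "det L = prod_list (diag_mat L)"
  proof (rule det_lower_triangular[OF _ carrier(1)])
    fix i j assume "i < j" "j < N"
    then have "(\<Prod>l<j. y i - y l) = 0" by (intro prod_zero) auto
    then show "L $$ (i, j) = 0" using \<open>i < j\<close> \<open>j < N\<close> by (simp add: L_def)
  qed
  also have "\<dots> = (\<Prod>i<N. \<Prod>l<i. y i - y l)"
    unfolding diag_mat_def using carrier(1)
    by (simp add: L_def prod.list_conv_set_nth lessThan_atLeast0)
  also have "\<dots> = (\<Prod>(i, l)\<in>(SIGMA i:{..<N}. {..<i}). y i - y l)"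
    by (rule prod.Sigma) auto
  \<comment> \<open>The diagonal has the larger index first, the Vandermonde product the smaller
    one; the resulting sign is harmless for divisibility.\<close>
  also have "\<dots> = (\<Prod>(i, j)\<in>{(i, j). 1 \<le> i \<and> i < j \<and> j \<le> N}. - 1 * (x i - x j))"
    by (rule prod.reindex_bij_witness[of _ "\<lambda>(i, j). (j - 1, i - 1)" "\<lambda>(i, l). (l + 1, i + 1)"])
      (auto simp: y_def)
  also have "\<dots> = (\<Prod>(i, j)\<in>{(i, j). 1 \<le> i \<and> i < j \<and> j \<le> N}. - 1) * Vandermonde N x"
    unfolding Vandermonde_def case_prod_unfold prod.distrib ..
  finally show ?thesis by (simp add: mult_ac)
qed

section \<open>Pfaffians as sums of alternants\<close>

definition decreasing_exponents :: "nat \<Rightarrow> nat \<Rightarrow> (nat \<Rightarrow> nat) set" where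
  "decreasing_exponents n D = {m \<in> {1..n} \<rightarrow>\<^sub>E {..<D}. \<forall>k\<in>{1..<n}. m (k + 1) < m k}"

definition pair_exponents :: "(nat \<Rightarrow> nat) \<Rightarrow> nat \<Rightarrow> nat" where
  "pair_exponents m j = (if even j then m (j div 2) else m (j div 2 + 1) + 1)"

lemma pair_exponents_even: "pair_exponents m (2*k) = m k"
  by (simp add: pair_exponents_def)

lemma pair_exponents_odd:
  assumes "1 \<le> k" shows "pair_exponents m (2*k - 1) = m k + 1"
proof -
  from assms obtain i where "k = i + 1" by (cases k) auto
  then show ?thesis by (simp add: pair_exponents_def)
qed

lemma alternant_pair_exponents:
  "alternant (2*n) (pair_exponents m) x = (\<Sum>q | q permutes {1..2*n}.
    of_int (sign q) * (\<Prod>k\<in>{1..n}. x (q (2*k - 1)) ^ (m k + 1) * x (q (2*k)) ^ m k))"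
proof -
  have "(\<Prod>j\<in>{1..2*n}. x (q j) ^ pair_exponents m j) =
      (\<Prod>k\<in>{1..n}. x (q (2*k - 1)) ^ (m k + 1) * x (q (2*k)) ^ m k)" for q
    unfolding prod_pairs by (intro prod.cong refl) (simp add: pair_exponents_even pair_exponents_odd[simplified])
  then show ?thesis unfolding alternant_Leibniz by simp
qed

text \<open>The key whose ordering picks the second fundamental domain: sort the blocks by decreasing
  exponent, and blocks of equal exponent by their first element. Within one exponent function
  having a repeated value, this leaves the second elements of the blocks free, so that exchanging
  two of them cancels all terms.\<close>

definition exponent_key :: "nat \<Rightarrow> (nat \<Rightarrow> nat) \<times> (nat \<Rightarrow> nat) \<Rightarrow> nat \<Rightarrow> int" where
  "exponent_key n x k = int (fst x (2*k - 1)) - int (snd x k) * int (2*n + 1)"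

lemma permutes_neq:
  assumes "q permutes A" "a \<noteq> b"
  shows "q a \<noteq> q b"
  using permutes_inj[OF assms(1)] assms(2) by (auto dest: injD)

text \<open>The values of \<open>q\<close> on \<open>{1..2*n}\<close> stay below the weight
  \<open>2*n + 1\<close>, so a single integer comparison is lexicographic: first the exponents in
  decreasing order, then the first elements.\<close>

lemma exponent_key_less_iff:
  assumes q: "q permutes {1..2*n}" and k: "k \<in> {1..n}" "l \<in> {1..n}"
  shows "exponent_key n (q, m) k < exponent_key n (q, m) l \<longleftrightarrow>
    m l < m k \<or> (m l = m k \<and> q (2*k - 1) < q (2*l - 1))"
proof -
  have b: "q (2*k - 1) < 2*n + 1" "q (2*l - 1) < 2*n + 1"
  proof -
    have "2*k - 1 \<in> {1..2*n}" "2*l - 1 \<in> {1..2*n}" using k by auto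
    then show "q (2*k - 1) < 2*n + 1" "q (2*l - 1) < 2*n + 1"
      using permutes_in_seg[OF q] by (fastforce simp: less_Suc_eq_le)+
  qed
  have lt: "exponent_key n (q, m) i < exponent_key n (q, m) j"
    if "m j < m i" "q (2*i - 1) < 2*n + 1" for i j
  proof -
    have "(int (m j) + 1) * int (2*n + 1) \<le> int (m i) * int (2*n + 1)"
      using that(1) by (intro mult_right_mono) auto
    then show ?thesis using that(2) by (simp add: exponent_key_def algebra_simps)
  qed
  show ?thesis
  proof (cases "m l = m k")
    case True
    then show ?thesis by (simp add: exponent_key_def)
  next
    case False
    then show ?thesis using lt[of l k] lt[of k l] b by (cases "m l < m k") auto
  qed
qed

lemma inj_on_exponent_key:
  assumes "q permutes {1..2*n}"
  shows "inj_on (exponent_key n (q, m)) {1..n}"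
proof (rule inj_onI, rule ccontr)
  fix k l assume kl: "k \<in> {1..n}" "l \<in> {1..n}"
    and eq: "exponent_key n (q, m) k = exponent_key n (q, m) l" and "k \<noteq> l"
  then have "2*k - 1 \<noteq> 2*l - 1" using pair_indices_distinct by auto
  then have "q (2*k - 1) \<noteq> q (2*l - 1)" by (rule permutes_neq[OF assms])
  then show False
    using exponent_key_less_iff[OF assms kl, of m] exponent_key_less_iff[OF assms kl(2,1), of m] eq
    by auto
qed

lemma inj_on_block_min:
  fixes q :: "nat \<Rightarrow> nat"
  assumes "q permutes {1..2*n}"
  shows "inj_on (\<lambda>k. min (q (2*k - 1)) (q (2*k))) {1..n}"
proof (rule inj_onI, rule ccontr)
  fix k l assume kl: "k \<in> {1..n}" "l \<in> {1..n}" "k \<noteq> l"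
    and eq: "min (q (2*k - 1)) (q (2*k)) = min (q (2*l - 1)) (q (2*l))"
  then have "q a \<noteq> q b" if "a \<in> {2*k - 1, 2*k}" "b \<in> {2*l - 1, 2*l}" for a b
    using that pair_indices_distinct[of k l] by (intro permutes_neq[OF assms]) auto
  then show False using eq by (auto simp: min_def split: if_splits)
qed

lemma pfaffian_expand:
  fixes x c :: "nat \<Rightarrow> 'a :: comm_ring_1"
  shows "pfaffian n (\<lambda>i j. \<Sum>m<D. c m * (x i ^ (m + 1) * x j ^ m - x i ^ m * x j ^ (m + 1))) =
    (\<Sum>m\<in>decreasing_exponents n D. (\<Prod>k\<in>{1..n}. c (m k)) * alternant (2*n) (pair_exponents m) x)"
proof -
  let ?P = "{q. q permutes {1..2*n}}"
  let ?M = "{1..n} \<rightarrow>\<^sub>E {..<D}"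
  \<comment> \<open>The cast to \<open>int\<close> gives both keys the common type that
    \<open>sum_sorted_transversals\<close> requires.\<close>
  let ?key1 = "\<lambda>y k. int (min (fst y (2*k - 1)) (fst y (2*k)))"
  have finP: "finite ?P" by (rule finite_permutations) simp
  have finM: "finite ?M" by (intro finite_PiE) auto
  \<comment> \<open>Half of an entry: summing \<open>h m i j - h m j i\<close> over \<open>m\<close>
    recovers it, which is the skew form that \<open>pfaffian_skew\<close> expands.\<close>
  define h where "h m a b = c m * (x a ^ (m + 1) * x b ^ m)" for m a b
  define F where "F y = of_int (sign (fst y)) * (\<Prod>k\<in>{1..n}. h (snd y k) (fst y (2*k - 1)) (fst y (2*k)))"
    for y
  define act where "act y g = (fst y \<circ> block_perm n g, snd y \<circ> g)"
    for y :: "(nat \<Rightarrow> nat) \<times> (nat \<Rightarrow> nat)" and g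
  have "pfaffian n (\<lambda>i j. \<Sum>m<D. c m * (x i ^ (m + 1) * x j ^ m - x i ^ m * x j ^ (m + 1))) =
      pfaffian n (\<lambda>i j. (\<Sum>m<D. h m i j) - (\<Sum>m<D. h m j i))"
    by (intro arg_cong[of _ _ "pfaffian n"] ext)
      (simp add: h_def algebra_simps sum_subtractf)
  also have "\<dots> = (\<Sum>q | q permutes {1..2*n} \<and> min_ordered n q.
      of_int (sign q) * (\<Prod>k\<in>{1..n}. \<Sum>m<D. h m (q (2*k - 1)) (q (2*k))))"
    by (rule pfaffian_skew)
  also have "\<dots> = (\<Sum>q | q permutes {1..2*n} \<and> min_ordered n q. \<Sum>m\<in>?M. F (q, m))"
  proof (intro sum.cong refl)
    fix q
    have "(\<Prod>k\<in>{1..n}. \<Sum>m<D. h m (q (2*k - 1)) (q (2*k))) =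
        (\<Sum>m\<in>?M. \<Prod>k\<in>{1..n}. h (m k) (q (2*k - 1)) (q (2*k)))"
      by (rule prod_sum_PiE) auto
    then show "of_int (sign q) * (\<Prod>k\<in>{1..n}. \<Sum>m<D. h m (q (2*k - 1)) (q (2*k))) =
        (\<Sum>m\<in>?M. F (q, m))"
      by (simp only: F_def sum_distrib_left fst_conv snd_conv)
  qed
  also have "\<dots> = sum F ({q. q permutes {1..2*n} \<and> min_ordered n q} \<times> ?M)"
    by (simp add: sum.cartesian_product)
  also have "{q. q permutes {1..2*n} \<and> min_ordered n q} \<times> ?M =
      {y \<in> ?P \<times> ?M. strict_mono_on {1..n} (?key1 y)}"
    unfolding min_ordered_def strict_mono_on_def of_nat_less_iff by fastforce
  also have "sum F \<dots> = sum F {y \<in> ?P \<times> ?M. strict_mono_on {1..n} (exponent_key n y)}"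
  proof (rule sum_sorted_transversals[where act = act])
    fix y g assume y: "y \<in> ?P \<times> ?M" and g: "g permutes {1..n}"
    obtain q m where qm: "y = (q, m)" "q permutes {1..2*n}" "m \<in> ?M" using y by auto
    have gk: "g k \<in> {1..n}" if "k \<in> {1..n}" for k using permutes_in_image[OF g] that by blast
    have "q \<circ> block_perm n g permutes {1..2*n}"
      by (rule permutes_compose[OF block_perm_permutes[OF g] qm(2)])
    moreover have "m \<circ> g \<in> ?M"
    proof (rule PiE_I)
      show "(m \<circ> g) k \<in> {..<D}" if "k \<in> {1..n}" for k using gk[OF that] qm(3) by auto
      show "(m \<circ> g) k = undefined" if "k \<notin> {1..n}" for k
        using permutes_not_in[OF g that] qm(3) that by (auto simp: PiE_def extensional_def)
    qed
    ultimately show "act y g \<in> ?P \<times> ?M" by (simp add: act_def qm)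
    show "?key1 (act y g) k = ?key1 y (g k)" if "k \<in> {1..n}" for k
      by (simp only: act_def fst_conv o_apply block_perm_even[OF g that] block_perm_odd[OF g that])
    show "exponent_key n (act y g) k = exponent_key n y (g k)" if "k \<in> {1..n}" for k
      by (simp only: exponent_key_def act_def fst_conv snd_conv o_apply block_perm_odd[OF g that])
    have sgn: "sign (q \<circ> block_perm n g) = sign q"
      using qm(2) block_perm_permutes[OF g] permutation_permutes sign_block_perm[OF g]
      by (subst sign_compose) auto
    have "(\<Prod>k\<in>{1..n}. h ((m \<circ> g) k) ((q \<circ> block_perm n g) (2*k - 1)) ((q \<circ> block_perm n g) (2*k))) =
        (\<Prod>k\<in>{1..n}. h (m (g k)) (q (2 * g k - 1)) (q (2 * g k)))"
      by (intro prod.cong refl) (simp only: o_apply block_perm_even[OF g] block_perm_odd[OF g])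
    also have "\<dots> = (\<Prod>k\<in>{1..n}. h (m k) (q (2*k - 1)) (q (2*k)))"
      by (rule prod.reindex_bij_betw[OF permutes_imp_bij[OF g]])
    finally show "F (act y g) = F y"
      by (simp only: F_def act_def qm(1) fst_conv snd_conv sgn)
  next
    fix y g h assume "g permutes {1..n}" "h permutes {1..n}"
    then show "act (act y g) h = act y (g \<circ> h)"
      by (simp add: act_def block_perm_comp o_assoc)
  next
    fix y
    show "act y id = y" by (simp add: act_def block_perm_id)
  next
    fix y assume "y \<in> ?P \<times> ?M"
    then obtain q m where qm: "y = (q, m)" "q permutes {1..2*n}" by auto
    show "inj_on (?key1 y) {1..n}"
      using inj_on_block_min[OF qm(2)] by (simp only: inj_on_def qm(1) fst_conv of_nat_eq_iff)
    show "inj_on (exponent_key n y) {1..n}"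
      unfolding qm(1) by (rule inj_on_exponent_key[OF qm(2)])
  qed
  also have "{y \<in> ?P \<times> ?M. strict_mono_on {1..n} (exponent_key n y)} =
      (\<lambda>(m, q). (q, m)) ` (SIGMA m:?M. {q. q permutes {1..2*n} \<and> strict_mono_on {1..n} (exponent_key n (q, m))})"
    by force
  also have "sum F \<dots> = (\<Sum>m\<in>?M. \<Sum>q | q permutes {1..2*n} \<and> strict_mono_on {1..n} (exponent_key n (q, m)). F (q, m))"
  proof -
    let ?T = "\<lambda>m. {q. q permutes {1..2*n} \<and> strict_mono_on {1..n} (exponent_key n (q, m))}"
    have fin: "\<forall>m\<in>?M. finite (?T m)"
      by (intro ballI finite_subset[OF _ finP]) blast
    have "inj_on (\<lambda>(m, q). (q, m)) (Sigma ?M ?T)"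
      by (auto simp: inj_on_def)
    then have "sum F ((\<lambda>(m, q). (q, m)) ` Sigma ?M ?T) = sum (F \<circ> (\<lambda>(m, q). (q, m))) (Sigma ?M ?T)"
      by (rule sum.reindex)
    also have "\<dots> = (\<Sum>(m, q)\<in>Sigma ?M ?T. F (q, m))"
      by (intro sum.cong refl) (simp add: split_beta)
    also have "\<dots> = (\<Sum>m\<in>?M. \<Sum>q\<in>?T m. F (q, m))"
      by (rule sum.Sigma[OF finM fin, symmetric])
    finally show ?thesis .
  qed
  also have "\<dots> = (\<Sum>m\<in>decreasing_exponents n D. \<Sum>q | q permutes {1..2*n}. F (q, m))"
  proof (rule sum.mono_neutral_cong_right[OF finM])
    show "decreasing_exponents n D \<subseteq> ?M" by (auto simp: decreasing_exponents_def)
    show "\<forall>m\<in>?M - decreasing_exponents n D.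
        (\<Sum>q | q permutes {1..2*n} \<and> strict_mono_on {1..n} (exponent_key n (q, m)). F (q, m)) = 0"
    proof
      fix m assume "m \<in> ?M - decreasing_exponents n D"
      then obtain k where k: "k \<in> {1..<n}" "m k \<le> m (k + 1)"
        by (auto simp: decreasing_exponents_def not_less)
      have kk: "k \<in> {1..n}" "k + 1 \<in> {1..n}" using k(1) by auto
      show "(\<Sum>q | q permutes {1..2*n} \<and> strict_mono_on {1..n} (exponent_key n (q, m)). F (q, m)) = 0"
      proof (cases "m k = m (k + 1)")
        case False
        \<comment> \<open>An ascent of \<open>m\<close> contradicts the sorting by decreasing
          exponent, whatever \<open>q\<close> is, so the inner sum is empty.\<close>
        have "\<not> strict_mono_on {1..n} (exponent_key n (q, m))" if "q permutes {1..2*n}" for q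
          using exponent_key_less_iff[OF that kk] k False kk
          by (auto dest!: strict_mono_onD[of _ _ k "k + 1"])
        then have "{q. q permutes {1..2*n} \<and> strict_mono_on {1..n} (exponent_key n (q, m))} = {}"
          by blast
        then show ?thesis by (simp only: sum.empty)
      next
        case True
        \<comment> \<open>The key reads odd positions only and does not notice this exchange. With
          equal exponents the two blocks merely trade their second variables, so the product stays
          the same while the sign flips.\<close>
        let ?s = "\<lambda>q :: nat \<Rightarrow> nat. q \<circ> transpose (2*k) (2*(k+1))"
        have odd: "?s q (2*j - 1) = q (2*j - 1)" if "j \<in> {1..n}" for q j
        proof -
          have "2*j - 1 \<noteq> 2*k" "2*j - 1 \<noteq> 2*(k+1)" using that by (simp, presburger)+
          then show ?thesis by (simp add: transpose_def)
        qed
        have at: "?s q (2*k) = q (2*(k+1))" "?s q (2*(k+1)) = q (2*k)" for q by simp_all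
        have other: "?s q (2*j) = q (2*j)" if "j \<noteq> k" "j \<noteq> k + 1" for q j
          using that by (simp add: transpose_def)
        show ?thesis
        proof (rule sum_permutes_eq_0[of "{1..2*n}" "2*k" "2*(k+1)"])
          show "2*k \<in> {1..2*n}" "2*(k+1) \<in> {1..2*n}" "2*k \<noteq> 2*(k+1)" using kk by auto
          fix q assume q: "q permutes {1..2*n}"
          show "strict_mono_on {1..n} (exponent_key n (?s q, m)) =
              strict_mono_on {1..n} (exponent_key n (q, m))"
          proof -
            have "exponent_key n (?s q, m) j = exponent_key n (q, m) j" if "j \<in> {1..n}" for j
              by (simp only: exponent_key_def fst_conv snd_conv odd[OF that])
            then show ?thesis unfolding strict_mono_on_def by metis
          qed
          have sgn: "sign (?s q) = - sign q"
            using q permutation_permutes[of q] 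
            by (subst sign_compose) (auto simp: permutation_swap_id sign_swap_id)
          let ?R = "{1..n} - {k} - {k + 1}"
          have split: "prod f {1..n} = f k * f (k + 1) * prod f ?R" for f :: "nat \<Rightarrow> 'a"
          proof -
            have "prod f {1..n} = f k * prod f ({1..n} - {k})"
              by (rule prod.remove[OF _ kk(1)]) simp
            also have "prod f ({1..n} - {k}) = f (k + 1) * prod f ?R"
              by (rule prod.remove) (use kk(2) in auto)
            finally show ?thesis by (simp only: mult.assoc)
          qed
          have "(\<Prod>j\<in>{1..n}. h (m j) (?s q (2*j - 1)) (?s q (2*j))) =
              (\<Prod>j\<in>{1..n}. h (m j) (q (2*j - 1)) (q (2*j)))"
          proof -
            have "(\<Prod>j\<in>?R. h (m j) (?s q (2*j - 1)) (?s q (2*j))) =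
                (\<Prod>j\<in>?R. h (m j) (q (2*j - 1)) (q (2*j)))"
            proof (intro prod.cong refl)
              fix j assume "j \<in> ?R"
              then have j: "j \<in> {1..n}" "j \<noteq> k" "j \<noteq> k + 1" by auto
              show "h (m j) (?s q (2*j - 1)) (?s q (2*j)) = h (m j) (q (2*j - 1)) (q (2*j))"
                by (simp only: odd[OF j(1)] other[OF j(2,3)])
            qed
            moreover have "h (m k) (?s q (2*k - 1)) (?s q (2*k)) *
                h (m (k + 1)) (?s q (2*(k+1) - 1)) (?s q (2*(k+1))) =
              h (m k) (q (2*k - 1)) (q (2*k)) * h (m (k + 1)) (q (2*(k+1) - 1)) (q (2*(k+1)))"
              unfolding odd[OF kk(1)] odd[OF kk(2)] at True[symmetric] h_def by (simp only: mult_ac)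
            ultimately show ?thesis unfolding split by (simp only:)
          qed
          then show "F (?s q, m) = - F (q, m)"
            by (simp only: F_def fst_conv snd_conv sgn of_int_minus mult_minus_left)
        qed simp
      qed
    qed
    fix m assume m: "m \<in> decreasing_exponents n D"
    \<comment> \<open>Without ties among the exponents, sorting puts no condition on
      \<open>q\<close>; the inner sum becomes the full Leibniz sum of an alternant.\<close>
    have "strict_mono_on {1..n} (exponent_key n (q, m))" if "q permutes {1..2*n}" for q
      unfolding strict_mono_on_consecutive_iff
    proof
      fix k assume k: "k \<in> {1..<n}"
      then have "k \<in> {1..n}" "k + 1 \<in> {1..n}" by auto
      from exponent_key_less_iff[OF that this] k m
      show "exponent_key n (q, m) k < exponent_key n (q, m) (k + 1)"
        by (auto simp: decreasing_exponents_def)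
    qed
    then show "(\<Sum>q | q permutes {1..2*n} \<and> strict_mono_on {1..n} (exponent_key n (q, m)). F (q, m)) =
        (\<Sum>q | q permutes {1..2*n}. F (q, m))"
      by (intro sum.cong refl) blast
  qed
  also have "\<dots> = (\<Sum>m\<in>decreasing_exponents n D.
      (\<Prod>k\<in>{1..n}. c (m k)) * alternant (2*n) (pair_exponents m) x)"
    unfolding alternant_pair_exponents sum_distrib_left F_def h_def prod.distrib fst_conv snd_conv
    by (intro sum.cong refl) (simp only: mult_ac)
  finally show ?thesis .
qed

lemma alternant_eq_0:
  assumes ab: "a \<in> {1..N}" "b \<in> {1..N}" "a \<noteq> b" and e: "e a = e b"
  shows "alternant N e x = 0"
proof -
  let ?f = "\<lambda>q. of_int (sign q) * (\<Prod>j\<in>{1..N}. x (q j) ^ e j)"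
  have "(\<Sum>q | q permutes {1..N} \<and> True. ?f q) = 0"
  proof (rule sum_permutes_eq_0[OF finite_atLeastAtMost ab])
    fix q assume q: "q permutes {1..N}"
    let ?s = "transpose a b"
    have "permutation q" using q permutation_permutes by blast
    then have sgn: "sign (q \<circ> ?s) = - sign q"
      using ab(3) by (subst sign_compose) (auto simp: permutation_swap_id sign_swap_id)
    have "e (?s j) = e j" for j using e by (simp add: transpose_def)
    then have "(\<Prod>j\<in>{1..N}. x ((q \<circ> ?s) j) ^ e j) = (\<Prod>j\<in>{1..N}. x (q (?s j)) ^ e (?s j))"
      by simp
    also have "\<dots> = (\<Prod>j\<in>{1..N}. x (q j) ^ e j)"
      by (rule prod.reindex_bij_betw[OF permutes_imp_bij[OF permutes_swap_id[OF ab(1,2)]]])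
    finally show "?f (q \<circ> ?s) = - ?f q"
      by (simp only: sgn of_int_minus mult_minus_left)
  qed simp
  then show ?thesis by (simp add: alternant_Leibniz)
qed

lemma alternant_cong:
  assumes "\<And>j. j \<in> {1..N} \<Longrightarrow> e j = e' j"
  shows "alternant N e x = alternant N e' x"
  unfolding alternant_Leibniz using assms by simp

lemma finite_decreasing_exponents: "finite (decreasing_exponents n D)"
  unfolding decreasing_exponents_def by (rule finite_Collect_conjI) (simp add: finite_PiE)

text \<open>Gaps of at least 2 are exactly what makes
  \<open>m 1 + 1, m 1, m 2 + 1, m 2, \<dots>\<close> strictly decreasing, as the exponents of a
  partition must be.\<close>

definition separated_exponents :: "nat \<Rightarrow> nat \<Rightarrow> (nat \<Rightarrow> nat) set" where
  "separated_exponents n D = {m \<in> {1..n} \<rightarrow>\<^sub>E {..<D}. \<forall>k\<in>{1..<n}. m (k + 1) + 1 < m k}"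

lemma separated_subset_decreasing: "separated_exponents n D \<subseteq> decreasing_exponents n D"
  by (fastforce simp: separated_exponents_def decreasing_exponents_def)

text \<open>If \<open>m k = m (k + 1) + 1\<close>, the positions \<open>2*k\<close> and
  \<open>2*(k + 1) - 1\<close> carry the same exponent, and the alternant has two equal
  columns.\<close>

lemma pfaffian_expand_separated:
  fixes x c :: "nat \<Rightarrow> 'a :: comm_ring_1"
  shows "pfaffian n (\<lambda>i j. \<Sum>m<D. c m * (x i ^ (m + 1) * x j ^ m - x i ^ m * x j ^ (m + 1))) =
    (\<Sum>m\<in>separated_exponents n D. (\<Prod>k\<in>{1..n}. c (m k)) * alternant (2*n) (pair_exponents m) x)"
  unfolding pfaffian_expand
proof (rule sum.mono_neutral_right[OF finite_decreasing_exponents separated_subset_decreasing], rule ballI)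
  fix m assume "m \<in> decreasing_exponents n D - separated_exponents n D"
  then obtain k where k: "k \<in> {1..<n}" "m (k + 1) < m k" "\<not> m (k + 1) + 1 < m k"
    by (auto simp: decreasing_exponents_def separated_exponents_def)
  have "alternant (2*n) (pair_exponents m) x = 0"
  proof (rule alternant_eq_0)
    show "2*k \<in> {1..2*n}" "2*(k+1) - 1 \<in> {1..2*n}" "2*k \<noteq> 2*(k+1) - 1" using k(1) by auto
    show "pair_exponents m (2*k) = pair_exponents m (2*(k+1) - 1)"
      using k(2,3) pair_exponents_odd[of "k + 1" m] by (simp only: pair_exponents_even)
  qed
  then show "(\<Prod>k\<in>{1..n}. c (m k)) * alternant (2*n) (pair_exponents m) x = 0" by simp
qed

section \<open>Truncation of power series\<close>

text \<open>Congruence modulo the ideal of series of order at least \<open>D\<close>; in particular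
  \<open>mfps_cong D f 0\<close> bounds the order of \<open>f\<close> from below.\<close>

definition mfps_cong :: "nat \<Rightarrow> 'a mfps \<Rightarrow> 'a mfps \<Rightarrow> bool" where
  "mfps_cong D f g \<longleftrightarrow> (\<forall>\<mu>. pm_deg \<mu> < D \<longrightarrow> mfps_nth f \<mu> = mfps_nth g \<mu>)"

lemma mfps_congI: "(\<And>\<mu>. pm_deg \<mu> < D \<Longrightarrow> mfps_nth f \<mu> = mfps_nth g \<mu>) \<Longrightarrow> mfps_cong D f g"
  by (simp add: mfps_cong_def)

lemma mfps_congD: "mfps_cong D f g \<Longrightarrow> pm_deg \<mu> < D \<Longrightarrow> mfps_nth f \<mu> = mfps_nth g \<mu>"
  by (simp add: mfps_cong_def)

lemma mfps_cong_refl [simp]: "mfps_cong D f f"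
  by (simp add: mfps_cong_def)

lemma mfps_cong_sym: "mfps_cong D f g \<Longrightarrow> mfps_cong D g f"
  by (simp add: mfps_cong_def)

lemma mfps_cong_trans [trans]: "mfps_cong D f g \<Longrightarrow> mfps_cong D g h \<Longrightarrow> mfps_cong D f h"
  by (simp add: mfps_cong_def)

lemma mfps_cong_mono: "mfps_cong D f g \<Longrightarrow> E \<le> D \<Longrightarrow> mfps_cong E f g"
  by (auto simp: mfps_cong_def)

lemma mfps_eq_if_cong: "(\<And>D. mfps_cong D f g) \<Longrightarrow> f = g"
  by (rule mfps_eqI) (auto simp: mfps_cong_def)

lemma pm_deg_splits:
  assumes "(a, b) \<in> splits \<mu>"
  shows "pm_deg \<mu> = pm_deg a + pm_deg b"
  using assms by (auto simp: pm_deg_add)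

context
  fixes f f' g g' :: "'a :: comm_ring_1 mfps" and D :: nat
  assumes cong: "mfps_cong D f f'" "mfps_cong D g g'"
begin

lemma mfps_cong_add: "mfps_cong D (f + g) (f' + g')"
  using cong by (simp add: mfps_cong_def)

lemma mfps_cong_mult: "mfps_cong D (f * g) (f' * g')"
proof (rule mfps_congI)
  fix \<mu> assume \<mu>: "pm_deg \<mu> < D"
  have "mfps_nth f a * mfps_nth g b = mfps_nth f' a * mfps_nth g' b" if "(a, b) \<in> splits \<mu>" for a b
    using cong \<mu> pm_deg_splits[OF that] by (simp add: mfps_cong_def)
  then show "mfps_nth (f * g) \<mu> = mfps_nth (f' * g') \<mu>"
    unfolding mfps_nth_mult by (intro sum.cong) auto
qed

end

lemma mfps_cong_sum:
  fixes f g :: "'b \<Rightarrow> 'a :: comm_ring_1 mfps"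
  shows "(\<And>i. i \<in> A \<Longrightarrow> mfps_cong D (f i) (g i)) \<Longrightarrow> mfps_cong D (sum f A) (sum g A)"
  by (induction A rule: infinite_finite_induct) (auto intro: mfps_cong_add)

lemma mfps_cong_prod:
  fixes f g :: "'b \<Rightarrow> 'a :: comm_ring_1 mfps"
  shows "(\<And>i. i \<in> A \<Longrightarrow> mfps_cong D (f i) (g i)) \<Longrightarrow> mfps_cong D (prod f A) (prod g A)"
  by (induction A rule: infinite_finite_induct) (auto intro: mfps_cong_mult)

lemma mfps_cong_0_mult:
  fixes f g :: "'a :: comm_ring_1 mfps"
  assumes "mfps_cong D f 0" "mfps_cong E g 0"
  shows "mfps_cong (D + E) (f * g) 0"
proof (rule mfps_congI)
  fix \<mu> assume \<mu>: "pm_deg \<mu> < D + E"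
  have "mfps_nth f a * mfps_nth g b = 0" if "(a, b) \<in> splits \<mu>" for a b
    using assms \<mu> pm_deg_splits[OF that] by (cases "pm_deg a < D") (auto simp: mfps_cong_def)
  then show "mfps_nth (f * g) \<mu> = mfps_nth 0 \<mu>"
    unfolding mfps_nth_mult by (auto intro!: sum.neutral)
qed

lemma mfps_cong_0_mult_left:
  fixes f g :: "'a :: comm_ring_1 mfps"
  assumes "mfps_cong D f 0"
  shows "mfps_cong D (f * g) 0"
  using mfps_cong_mult[OF assms mfps_cong_refl, of g] by simp

lemma mfps_cong_0_power:
  fixes f :: "'a :: comm_ring_1 mfps"
  shows "mfps_cong D f 0 \<Longrightarrow> mfps_cong (D * n) (f ^ n) 0"
  by (induction n) (auto intro: mfps_cong_0_mult simp: mfps_cong_def[of 0])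

lemma mfps_nth_var: "mfps_nth (mfps_var i) \<mu> = (if \<mu> = Poly_Mapping.single i 1 then 1 else 0)"
  by transfer simp

lemma pm_deg_single: "pm_deg (Poly_Mapping.single i k) = k"
  by (simp add: pm_deg_def)

lemma mfps_cong_0_var_power: "mfps_cong n (mfps_var i ^ n :: 'a :: comm_ring_1 mfps) 0"
proof -
  have "mfps_cong 1 (mfps_var i :: 'a mfps) 0"
    by (auto simp: mfps_cong_def mfps_nth_var pm_deg_single)
  from mfps_cong_0_power[OF this, of n] show ?thesis by simp
qed

section \<open>Cancellation of homogeneous factors\<close>

definition homogeneous :: "nat \<Rightarrow> 'a :: zero mfps \<Rightarrow> bool" where
  "homogeneous d f \<longleftrightarrow> (\<forall>\<mu>. mfps_nth f \<mu> \<noteq> 0 \<longrightarrow> pm_deg \<mu> = d)"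

lemma homogeneous_mult:
  fixes f g :: "'a :: comm_ring_1 mfps"
  assumes "homogeneous d f" "homogeneous e g"
  shows "homogeneous (d + e) (f * g)"
  unfolding homogeneous_def
proof (intro allI impI)
  fix \<mu> assume "mfps_nth (f * g) \<mu> \<noteq> 0"
  then obtain a b where ab: "(a, b) \<in> splits \<mu>" "mfps_nth f a * mfps_nth g b \<noteq> 0"
    unfolding mfps_nth_mult by (auto elim!: sum.not_neutral_contains_not_neutral)
  then have "mfps_nth f a \<noteq> 0" "mfps_nth g b \<noteq> 0" by auto
  then show "pm_deg \<mu> = d + e"
    using assms pm_deg_splits[OF ab(1)] by (auto simp: homogeneous_def)
qed

lemma homogeneous_prod:
  fixes f :: "'b \<Rightarrow> 'a :: comm_ring_1 mfps"
  shows "(\<And>i. i \<in> A \<Longrightarrow> homogeneous (d i) (f i)) \<Longrightarrow> homogeneous (sum d A) (prod f A)"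
proof (induction A rule: infinite_finite_induct)
  case (insert i A)
  then show ?case using homogeneous_mult[of "d i" "f i" "sum d A" "prod f A"] by simp
qed (auto simp: homogeneous_def pm_deg_def)

text \<open>Dividing by a homogeneous series of degree \<open>d\<close> costs \<open>d\<close>
  degrees of precision. This carries order estimates from alternants over to Schur
  polynomials.\<close>

lemma mfps_cong_0_cancel:
  fixes f g :: "'a :: idom mfps"
  assumes f: "homogeneous d f" "f \<noteq> 0" and fg: "mfps_cong (d + D) (f * g) 0"
  shows "mfps_cong D g 0"
proof -
  \<comment> \<open>\<open>h\<close> is \<open>g\<close> cut off at degree \<open>D\<close>. Below
    degree \<open>d + D\<close> the products of \<open>f\<close> with \<open>g\<close> and with
    \<open>h\<close> agree, and from there on \<open>f * h\<close> vanishes because \<open>f\<close>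
    lives in degree \<open>d\<close> alone. So \<open>f * h\<close> is exactly 0, and the absence of
    zero divisors applies.\<close>
  define h where "h = Abs_mfps (\<lambda>\<mu>. if pm_deg \<mu> < D then mfps_nth g \<mu> else 0)"
  have h: "mfps_nth h \<mu> = (if pm_deg \<mu> < D then mfps_nth g \<mu> else 0)" for \<mu>
    by (simp add: h_def Abs_mfps_inverse)
  have "mfps_nth (f * h) \<mu> = 0" for \<mu>
  proof (cases "pm_deg \<mu> < d + D")
    case True
    have "mfps_nth f a * mfps_nth h b = mfps_nth f a * mfps_nth g b" if "(a, b) \<in> splits \<mu>" for a b
      using f(1) True pm_deg_splits[OF that] by (cases "mfps_nth f a = 0") (auto simp: h homogeneous_def)
    then have "mfps_nth (f * h) \<mu> = mfps_nth (f * g) \<mu>"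
      unfolding mfps_nth_mult by (intro sum.cong) auto
    then show ?thesis using mfps_congD[OF fg True] by simp
  next
    case False
    have "mfps_nth f a * mfps_nth h b = 0" if "(a, b) \<in> splits \<mu>" for a b
      using f(1) False pm_deg_splits[OF that] by (cases "mfps_nth f a = 0") (auto simp: h homogeneous_def)
    then show ?thesis
      unfolding mfps_nth_mult by (auto intro!: sum.neutral)
  qed
  then have "f * h = 0" by (intro mfps_eqI) simp
  then have "h = 0" using f(2) by simp
  then have "mfps_nth h \<mu> = 0" for \<mu> by simp
  then show ?thesis unfolding mfps_cong_def h by (metis mfps_nth_simps(1))
qed

definition mfps_series :: "(nat \<Rightarrow> 'a mfps) \<Rightarrow> 'a mfps \<Rightarrow> 'a :: comm_ring_1 mfps" where
  "mfps_series c u = Abs_mfps (\<lambda>\<mu>. mfps_nth (\<Sum>m\<le>pm_deg \<mu>. c m * u ^ m) \<mu>)"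

text \<open>For \<open>u\<close> without constant term, \<open>u ^ m\<close> has order at least
  \<open>m\<close>, so the degree-dependent cutoff in \<open>mfps_series\<close> discards nothing
  and the series is the infinite sum of \<open>c m * u ^ m\<close>.\<close>

lemma mfps_cong_series:
  assumes "mfps_cong 1 u 0"
  shows "mfps_cong D (mfps_series c u) (\<Sum>m<D. c m * u ^ m)"
proof (rule mfps_congI)
  fix \<mu> assume \<mu>: "pm_deg \<mu> < D"
  have nth_sum: "mfps_nth (sum f A) \<mu> = (\<Sum>m\<in>A. mfps_nth (f m) \<mu>)" for f :: "nat \<Rightarrow> 'a mfps" and A
    by (induction A rule: infinite_finite_induct) auto
  have "mfps_nth (c m * u ^ m) \<mu> = 0" if "pm_deg \<mu> < m" for m
    using mfps_congD[OF mfps_cong_0_mult_left[OF mfps_cong_0_power[OF assms, of m], of "c m"], of \<mu>] that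
    by (simp add: mult.commute)
  then have "(\<Sum>m<D. mfps_nth (c m * u ^ m) \<mu>) = (\<Sum>m\<le>pm_deg \<mu>. mfps_nth (c m * u ^ m) \<mu>)"
    using \<mu> by (intro sum.mono_neutral_right) auto
  then show "mfps_nth (mfps_series c u) \<mu> = mfps_nth (\<Sum>m<D. c m * u ^ m) \<mu>"
    by (simp add: mfps_series_def Abs_mfps_inverse nth_sum)
qed

text \<open>Partial fractions: (1 - t) / ((1 - u)(1 - tu)) = 1/(1 - u) - t/(1 - tu). The remainder
  of the two truncated geometric series is a multiple of \<open>u ^ D\<close>.\<close>

lemma geometric_difference_sum:
  fixes t u :: "'a :: comm_ring_1"
  shows "(1 - u) * (1 - t * u) * (\<Sum>m<D. (1 - t ^ (m + 1)) * u ^ m) =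
    (1 - t) + u ^ D * (t ^ (D + 1) * (1 - u) - (1 - t * u))"
  by (induction D) (simp_all add: algebra_simps)

lemma geometric_difference_series:
  fixes t u :: "'a :: comm_ring_1 mfps"
  assumes "mfps_cong 1 u 0"
  shows "(1 - u) * (1 - t * u) * mfps_series (\<lambda>m. 1 - t ^ (m + 1)) u = 1 - t"
proof (rule mfps_eq_if_cong)
  fix D
  have "mfps_cong D ((1 - u) * (1 - t * u) * mfps_series (\<lambda>m. 1 - t ^ (m + 1)) u)
      ((1 - u) * (1 - t * u) * (\<Sum>m<D. (1 - t ^ (m + 1)) * u ^ m))"
    by (intro mfps_cong_mult mfps_cong_refl mfps_cong_series assms)
  also have "\<dots> = (1 - t) + u ^ D * (t ^ (D + 1) * (1 - u) - (1 - t * u))"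
    by (rule geometric_difference_sum)
  also have "mfps_cong D \<dots> ((1 - t) + 0)"
    using mfps_cong_0_power[OF assms, of D] by (intro mfps_cong_add mfps_cong_0_mult_left) auto
  finally show "mfps_cong D ((1 - u) * (1 - t * u) * mfps_series (\<lambda>m. 1 - t ^ (m + 1)) u) (1 - t)"
    by simp
qed

lemma mfps_cong_pfaffian:
  fixes a b :: "nat \<Rightarrow> nat \<Rightarrow> 'a :: comm_ring_1 mfps"
  assumes "\<And>i j. mfps_cong D (a i j) (b i j)"
  shows "mfps_cong D (pfaffian n a) (pfaffian n b)"
  unfolding pfaffian_def
  by (intro mfps_cong_sum mfps_cong_mult mfps_cong_refl mfps_cong_prod assms)

section \<open>Passage to the field of fractions\<close>

lemma to_fract_prod: "to_fract (prod f A) = (\<Prod>i\<in>A. to_fract (f i))"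
  by (induction A rule: infinite_finite_induct) auto

lemma to_fract_of_int: "to_fract (of_int k) = of_int k"
proof -
  have "to_fract (of_nat m :: 'a) = of_nat m" for m by (induction m) auto
  then show ?thesis by (cases k) (auto simp del: of_nat_Suc)
qed

lemma to_fract_pfaffian: "to_fract (pfaffian n a) = pfaffian n (\<lambda>i j. to_fract (a i j))"
  by (simp add: pfaffian_def to_fract_prod to_fract_of_int)

section \<open>Partitions with paired parts\<close>

definition paired_partitions :: "nat \<Rightarrow> nat list set" where
  "paired_partitions n = {l. is_partition l \<and> length l \<le> 2*n \<and> even_parts (conjugate_partition l)}"

lemma part_antimono:
  assumes "is_partition l" "1 \<le> i" "i \<le> j"
  shows "part l j \<le> part l i"
proof (cases "i < j \<and> j \<le> length l")
  case True
  then have "l ! (i - 1) \<ge> l ! (j - 1)"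
    using assms by (intro sorted_wrt_nth_less[of "(\<ge>)"]) (auto simp: is_partition_def)
  then show ?thesis using True assms by (simp add: part_def)
next
  case False
  then show ?thesis using assms by (cases "i = j") (auto simp: part_def)
qed

lemma part_pos_iff:
  assumes "is_partition l"
  shows "0 < part l i \<longleftrightarrow> 1 \<le> i \<and> i \<le> length l"
proof -
  have "l ! (i - 1) \<noteq> 0" if "1 \<le> i" "i \<le> length l"
  proof -
    have "l ! (i - 1) \<in> set l" using that by (intro nth_mem) simp
    then show ?thesis using assms by (metis is_partition_def)
  qed
  then show ?thesis by (auto simp: part_def)
qed

text \<open>The padded parts determine the list, since its length is the last index with a positive
  part.\<close>

lemma is_partition_eqI:
  assumes l: "is_partition l" and l': "is_partition l'" and eq: "\<And>i. 1 \<le> i \<Longrightarrow> part l i = part l' i"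
  shows "l = l'"
proof (rule nth_equalityI)
  have "1 \<le> i \<and> i \<le> length l \<longleftrightarrow> 1 \<le> i \<and> i \<le> length l'" for i
    unfolding part_pos_iff[OF l, symmetric] part_pos_iff[OF l', symmetric]
    using eq[of i] by (cases "i = 0") (auto simp: part_def)
  from this[of "length l"] this[of "length l'"] show len: "length l = length l'"
    by (cases "length l"; cases "length l'") auto
  fix i assume "i < length l"
  then show "l ! i = l' ! i" using eq[of "i + 1"] len by (simp add: part_def)
qed

text \<open>Trailing zeros must be dropped, hence the induction on \<open>N\<close>: either the last
  value is 0 and can be left to the padding, or by monotonicity all values are positive and the
  whole list is a partition.\<close>

lemma ex_partition_with_parts:
  assumes "\<And>i. 1 \<le> i \<Longrightarrow> i < N \<Longrightarrow> p (i + 1) \<le> (p i :: nat)"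
  obtains l where "is_partition l" "length l \<le> N" "\<And>i. 1 \<le> i \<Longrightarrow> i \<le> N \<Longrightarrow> part l i = p i"
  using assms
proof (induction N arbitrary: thesis)
  case 0
  then show ?case by (auto simp: is_partition_def)
next
  case (Suc N)
  have anti: "p j \<le> p i" if "1 \<le> i" "i \<le> j" "j \<le> Suc N" for i j
    using that(2,3)
  proof (induction j rule: dec_induct)
    case (step j)
    then show ?case using Suc.prems(2)[of j] \<open>1 \<le> i\<close> by simp
  qed simp
  show ?case
  proof (cases "p (Suc N) = 0")
    case True
    obtain l where l: "is_partition l" "length l \<le> N" "\<And>i. 1 \<le> i \<Longrightarrow> i \<le> N \<Longrightarrow> part l i = p i"
      using Suc.IH Suc.prems(2) by (metis less_SucI)
    have "part l (Suc N) = p (Suc N)" using l(2) True by (simp add: part_def)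
    with l Suc.prems(1)[of l] show ?thesis by (metis le_SucI le_Suc_eq)
  next
    case False
    let ?l = "map p [1..<Suc (Suc N)]"
    have nth: "?l ! i = p (i + 1)" if "i < Suc N" for i
      using that by (simp del: upt_Suc)
    have "is_partition ?l"
      unfolding is_partition_def
    proof
      show "sorted_wrt (\<ge>) ?l"
        unfolding sorted_wrt_iff_nth_less using nth anti by (auto simp del: upt_Suc)
      have "p i \<noteq> 0" if "1 \<le> i" "i \<le> Suc N" for i
        using anti[of i "Suc N"] that False by auto
      then show "0 \<notin> set ?l" by (force simp del: upt_Suc)
    qed
    moreover have "part ?l i = p i" if "1 \<le> i" "i \<le> Suc N" for i
      using that nth[of "i - 1"] by (simp add: part_def del: upt_Suc)
    ultimately show ?thesis using Suc.prems(1)[of ?l] by (simp del: upt_Suc)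
  qed
qed

lemma downward_closed_eq_interval:
  fixes A :: "nat set"
  assumes "finite A" "0 \<notin> A" "\<And>i j. j \<in> A \<Longrightarrow> 1 \<le> i \<Longrightarrow> i \<le> j \<Longrightarrow> i \<in> A"
  shows "A = {1..card A}"
proof (cases "A = {}")
  case False
  have "A = {1..Max A}"
  proof
    show "A \<subseteq> {1..Max A}"
    proof
      fix i assume i: "i \<in> A"
      then have "i \<noteq> 0" using assms(2) by metis
      then show "i \<in> {1..Max A}" using i assms(1) by simp
    qed
    show "{1..Max A} \<subseteq> A"
      using assms(3)[OF Max_in[OF assms(1) False]] by auto
  qed
  then show ?thesis by (metis card_atLeastAtMost diff_Suc_1 One_nat_def)
qed simp

text \<open>\<open>A j\<close> is the \<open>j\<close>-th column of the diagram, an initial interval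
  of rows. If row \<open>2*k - 1\<close> is longer than row \<open>2*k\<close>, the column through
  its last cell has odd length \<open>2*k - 1\<close>. Conversely, a column of odd length
  \<open>2*i + 1\<close> would extend into row \<open>2*i + 2\<close>, which is as long as row
  \<open>2*i + 1\<close>.\<close>

lemma even_parts_conjugate_iff:
  assumes l: "is_partition l" "length l \<le> 2*n"
  shows "even_parts (conjugate_partition l) \<longleftrightarrow> (\<forall>k\<in>{1..n}. part l (2*k - 1) = part l (2*k))"
proof -
  define A where "A j = {i \<in> {1..length l}. j \<le> part l i}" for j
  have even: "even_parts (conjugate_partition l) \<longleftrightarrow> (\<forall>j\<in>{1..part l 1}. even (card (A j)))"
    unfolding even_parts_def conjugate_partition_def A_def by (auto simp del: upt_Suc)
  have A: "A j = {1..card (A j)}" for j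
  proof (rule downward_closed_eq_interval)
    fix i i' assume "i' \<in> A j" "1 \<le> i" "i \<le> i'"
    then show "i \<in> A j" using part_antimono[OF l(1), of i i'] by (auto simp: A_def)
  qed (auto simp: A_def)
  show ?thesis
  proof
    assume *: "even_parts (conjugate_partition l)"
    show "\<forall>k\<in>{1..n}. part l (2*k - 1) = part l (2*k)"
    proof (rule ballI, rule ccontr)
      fix k assume k: "k \<in> {1..n}" and "part l (2*k - 1) \<noteq> part l (2*k)"
      then have less: "part l (2*k) < part l (2*k - 1)"
        using part_antimono[OF l(1), of "2*k - 1" "2*k"] by fastforce
      let ?j = "part l (2*k - 1)"
      have "A ?j = {1..2*k - 1}"
      proof (rule equalityI; rule subsetI)
        fix i assume i: "i \<in> A ?j"
        show "i \<in> {1..2*k - 1}"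
        proof (rule ccontr)
          assume "i \<notin> {1..2*k - 1}"
          then have "part l i \<le> part l (2*k)"
            using i k by (intro part_antimono[OF l(1)]) (auto simp: A_def)
          then show False using i less by (simp add: A_def)
        qed
      next
        fix i assume i: "i \<in> {1..2*k - 1}"
        then have "?j \<le> part l i" by (intro part_antimono[OF l(1)]) auto
        moreover from this have "i \<le> length l"
          using less part_pos_iff[OF l(1), of i] by simp
        ultimately show "i \<in> A ?j" using i by (simp add: A_def)
      qed
      then have "odd (card (A ?j))" using k by simp
      moreover have "?j \<in> {1..part l 1}"
        using less k part_antimono[OF l(1), of 1 "2*k - 1"] by auto
      ultimately show False using * even by blast
    qed
  next
    assume *: "\<forall>k\<in>{1..n}. part l (2*k - 1) = part l (2*k)"
    show "even_parts (conjugate_partition l)"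
      unfolding even
    proof (rule ballI, rule ccontr)
      fix j assume j: "j \<in> {1..part l 1}" and "odd (card (A j))"
      then obtain i where i: "card (A j) = 2*i + 1" by (blast elim: oddE)
      have "2*i + 1 \<in> A j" using A[of j] i by (metis atLeastAtMost_iff le_add2 order_refl)
      then have "2*i + 1 \<le> length l" "j \<le> part l (2*i + 1)" by (auto simp: A_def)
      moreover have "part l (2*(i+1) - 1) = part l (2*(i+1))"
        using * \<open>2*i + 1 \<le> length l\<close> l(2) by (intro bspec[OF *]) auto
      ultimately have "j \<le> part l (2*i + 2)" by simp
      then have "2*i + 2 \<in> A j"
        using j part_pos_iff[OF l(1), of "2*i + 2"] by (auto simp: A_def)
      then have "2*i + 2 \<le> card (A j)" using A[of j] by (metis atLeastAtMost_iff)
      then show False using i by simp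
    qed
  qed
qed

section \<open>Paired partitions as separated exponents\<close>

lemma paired_partitionsD:
  assumes "l \<in> paired_partitions n" "k \<in> {1..n}"
  shows "part l (2*k - 1) = part l (2*k)"
  using assms even_parts_conjugate_iff[of l n] by (auto simp: paired_partitions_def)

text \<open>The alternant exponents at even positions. The restriction to \<open>{1..n}\<close>
  places the function in the extensional space of \<open>separated_exponents\<close>, so that the
  correspondence can be a bijection.\<close>

definition half_exponents :: "nat \<Rightarrow> nat list \<Rightarrow> nat \<Rightarrow> nat" where
  "half_exponents n l = (\<lambda>k\<in>{1..n}. part l (2*k) + 2*n - 2*k)"

lemma half_exponents_apply:
  "k \<in> {1..n} \<Longrightarrow> half_exponents n l k = part l (2*k) + 2*n - 2*k"
  by (simp add: half_exponents_def)

text \<open>Downward induction from \<open>k = n\<close>, each step gaining 2. The bound ensures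
  that the subtraction recovering a part from its exponent is not truncated.\<close>

lemma separated_lower_bound:
  assumes m: "m \<in> separated_exponents n D" and k: "1 \<le> k" "k \<le> n"
  shows "2*n - 2*k \<le> m k"
  using k(2,1)
proof (induction k rule: inc_induct)
  case (step k)
  then have "m (k + 1) + 1 < m k" using m by (auto simp: separated_exponents_def)
  then show ?case using step by simp
qed simp

lemma half_exponents_separated:
  assumes l: "l \<in> paired_partitions n" and D: "\<And>k. k \<in> {1..n} \<Longrightarrow> half_exponents n l k < D"
  shows "half_exponents n l \<in> separated_exponents n D"
proof -
  have "half_exponents n l (k + 1) + 1 < half_exponents n l k" if k: "k \<in> {1..<n}" for k
  proof -
    have "part l (2*(k+1)) \<le> part l (2*k)"
      using l k by (intro part_antimono) (auto simp: paired_partitions_def)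
    then show ?thesis using k by (auto simp: half_exponents_apply)
  qed
  moreover have "half_exponents n l \<in> {1..n} \<rightarrow>\<^sub>E {..<D}"
    using D by (auto simp: half_exponents_def PiE_def extensional_def)
  ultimately show ?thesis by (auto simp: separated_exponents_def)
qed

lemma inj_on_half_exponents: "inj_on (half_exponents n) (paired_partitions n)"
proof (rule inj_onI)
  fix l l' assume l: "l \<in> paired_partitions n" and l': "l' \<in> paired_partitions n"
    and eq: "half_exponents n l = half_exponents n l'"
  have ev: "part l (2*k) = part l' (2*k)" if "k \<in> {1..n}" for k
    using fun_cong[OF eq, of k] that by (auto simp: half_exponents_apply)
  have "part l i = part l' i" if "1 \<le> i" for i
  proof (cases "i \<le> 2*n")
    case True
    show ?thesis
    proof (cases "even i")
      case True
      then show ?thesis using ev[of "i div 2"] \<open>i \<le> 2*n\<close> \<open>1 \<le> i\<close> by auto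
    next
      case False
      then obtain k where k: "i = 2*k + 1" by (blast elim: oddE)
      then have "k + 1 \<in> {1..n}" using True by simp
      from ev[OF this] paired_partitionsD[OF l this] paired_partitionsD[OF l' this] k
      show ?thesis by simp
    qed
  next
    case False
    then show ?thesis using l l' by (simp add: part_def paired_partitions_def)
  qed
  then show "l = l'"
    using l l' by (intro is_partition_eqI) (auto simp: paired_partitions_def)
qed

lemma separated_exponents_surj:
  assumes m: "m \<in> separated_exponents n D"
  obtains l where "l \<in> paired_partitions n" "half_exponents n l = m"
proof -
  \<comment> \<open>\<open>(j + 1) div 2\<close> is the block containing position \<open>j\<close>,
    so both positions of a block receive the same part, obtained by inverting
    \<open>half_exponents\<close>.\<close>
  define p where "p j = m ((j + 1) div 2) - (2*n - 2*((j + 1) div 2))" for j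
  have "p (i + 1) \<le> p i" if i: "1 \<le> i" "i < 2*n" for i
  proof (cases "even i")
    case True
    then obtain k where k: "i = 2*k" by (rule evenE)
    then have kn: "k \<in> {1..<n}" using i by auto
    \<comment> \<open>Between blocks the staircase drops by 2, and a gap of at least 2 in
      \<open>m\<close> is what keeps the parts weakly decreasing.\<close>
    then have "m (k + 1) + 1 < m k" using m by (auto simp: separated_exponents_def)
    then show ?thesis using kn by (simp add: p_def k)
  next
    case False
    then obtain k where "i = 2*k + 1" by (rule oddE)
    then show ?thesis by (simp add: p_def)
  qed
  then obtain l where l: "is_partition l" "length l \<le> 2*n" "\<And>i. 1 \<le> i \<Longrightarrow> i \<le> 2*n \<Longrightarrow> part l i = p i"
    using ex_partition_with_parts[of "2*n" p] by blast
  have even: "part l (2*k) = m k - (2*n - 2*k)" if "k \<in> {1..n}" for k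
    using l(3)[of "2*k"] that by (simp add: p_def)
  have odd: "part l (2*k - 1) = m k - (2*n - 2*k)" if "k \<in> {1..n}" for k
  proof -
    have "(2*k - 1 + 1) div 2 = k" using that by simp
    then show ?thesis using l(3)[of "2*k - 1"] that by (simp only: p_def) auto
  qed
  have "l \<in> paired_partitions n"
    using l(1,2) even odd even_parts_conjugate_iff[OF l(1,2)] by (simp add: paired_partitions_def)
  moreover have "half_exponents n l = m"
  proof
    fix k show "half_exponents n l k = m k"
    proof (cases "k \<in> {1..n}")
      case True
      then show ?thesis
        using even[OF True] separated_lower_bound[OF m, of k] by (simp add: half_exponents_apply)
    next
      case False
      then show ?thesis using m by (auto simp: half_exponents_def separated_exponents_def PiE_def extensional_def)
    qed
  qed
  ultimately show thesis by (rule that)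
qed

section \<open>The generating function\<close>

text \<open>Every Leibniz term contains some variable to the power \<open>e j\<close>, so one large
  exponent forces a large order.\<close>

lemma mfps_cong_0_alternant:
  assumes "j \<in> {1..N}" "D \<le> e j"
  shows "mfps_cong D (alternant N e mfps_var :: 'a :: comm_ring_1 mfps) 0"
proof -
  have "mfps_cong D (of_int (sign q) * (\<Prod>j\<in>{1..N}. mfps_var (q j) ^ e j) :: 'a mfps) 0" for q
  proof -
    have "mfps_cong D (mfps_var (q j) ^ e j :: 'a mfps) 0"
      by (rule mfps_cong_mono[OF mfps_cong_0_var_power assms(2)])
    then have "mfps_cong D (mfps_var (q j) ^ e j *
        ((\<Prod>j\<in>{1..N} - {j}. mfps_var (q j) ^ e j) * of_int (sign q)) :: 'a mfps) 0"
      by (rule mfps_cong_0_mult_left)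
    then show ?thesis
      using prod.remove[OF finite_atLeastAtMost assms(1), of "\<lambda>j. mfps_var (q j) ^ e j :: 'a mfps"]
      by (simp add: mult_ac)
  qed
  then have "mfps_cong D (alternant N e mfps_var :: 'a mfps) (\<Sum>q | q permutes {1..N}. 0)"
    unfolding alternant_Leibniz by (intro mfps_cong_sum)
  then show ?thesis by simp
qed

text \<open>A coefficient of degree below \<open>D\<close> only sees the finitely many members in
  \<open>L D\<close>. Thus the sum exists coefficientwise and is approximated by the finite sums
  over \<open>L D\<close>.\<close>

lemma has_sum_mfps_filtered:
  fixes F :: "'b \<Rightarrow> 'a :: comm_ring_1 mfps"
  assumes fin: "\<And>D. finite (L D)" "\<And>D. L D \<subseteq> A"
    and F: "\<And>D l. l \<in> A \<Longrightarrow> l \<notin> L D \<Longrightarrow> mfps_cong D (F l) 0"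
  obtains S where "(F has_sum S) A" "\<And>D. mfps_cong D S (\<Sum>l\<in>L D. F l)"
proof -
  define Z where "Z \<mu> = {l \<in> A. mfps_nth (F l) \<mu> \<noteq> 0}" for \<mu>
  have Z: "Z \<mu> \<subseteq> L D" if "pm_deg \<mu> < D" for \<mu> D
    using mfps_congD[OF F that] by (auto simp: Z_def)
  define S where "S = Abs_mfps (\<lambda>\<mu>. \<Sum>l\<in>Z \<mu>. mfps_nth (F l) \<mu>)"
  have S: "mfps_nth S \<mu> = (\<Sum>l\<in>Z \<mu>. mfps_nth (F l) \<mu>)" for \<mu>
    by (simp add: S_def Abs_mfps_inverse)
  have nth_sum: "mfps_nth (sum F B) \<mu> = (\<Sum>l\<in>B. mfps_nth (F l) \<mu>)" for B \<mu>
    by (induction B rule: infinite_finite_induct) auto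
  show thesis
  proof (rule that)
    have "finite (Z \<mu>)" for \<mu>
      by (rule finite_subset[OF Z[of \<mu> "Suc (pm_deg \<mu>)"] fin(1)]) simp
    then show "(F has_sum S) A"
      unfolding has_sum_mfps_iff S by (simp add: Z_def)
    fix D show "mfps_cong D S (\<Sum>l\<in>L D. F l)"
    proof (rule mfps_congI)
      fix \<mu> assume "pm_deg \<mu> < D"
      then show "mfps_nth S \<mu> = mfps_nth (\<Sum>l\<in>L D. F l) \<mu>"
        unfolding S nth_sum
        using fin(2)[of D] by (intro sum.mono_neutral_left fin(1) Z) (auto simp: Z_def)
    qed
  qed
qed

section \<open>The Vandermonde product and Schur polynomials\<close>

lemma mfps_var_neq:
  assumes "i \<noteq> j"
  shows "mfps_var i - mfps_var j \<noteq> (0 :: 'a :: comm_ring_1 mfps)"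
proof
  assume "mfps_var i - mfps_var j = (0 :: 'a mfps)"
  then have "mfps_nth (mfps_var i - mfps_var j :: 'a mfps) (Poly_Mapping.single i 1) = 0" by simp
  moreover have "Poly_Mapping.single i (1::nat) \<noteq> Poly_Mapping.single j 1"
    using assms by (metis lookup_single_eq lookup_single_not_eq zero_neq_one)
  ultimately show False by (simp add: mfps_nth_var)
qed

lemma homogeneous_var_diff: "homogeneous 1 (mfps_var i - mfps_var j :: 'a :: comm_ring_1 mfps)"
  by (auto simp: homogeneous_def mfps_nth_var pm_deg_single split: if_splits)

lemma Vandermonde_var_nonzero: "Vandermonde N mfps_var \<noteq> (0 :: 'a :: idom mfps)"
  unfolding Vandermonde_def prod_zero_iff[OF finite_index_pairs]
  by clarsimp (metis mfps_var_neq less_irrefl right_minus_eq)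

lemma homogeneous_Vandermonde:
  obtains d where "homogeneous d (Vandermonde N mfps_var :: 'a :: comm_ring_1 mfps)"
proof -
  have "homogeneous (\<Sum>p\<in>{(i, j). 1 \<le> i \<and> i < j \<and> j \<le> N}. 1) (Vandermonde N mfps_var :: 'a mfps)"
    unfolding Vandermonde_def by (rule homogeneous_prod) (use homogeneous_var_diff in auto)
  then show thesis by (rule that)
qed

text \<open>The division in \<open>schur\<close> is exact: the divisor divides the alternant and is
  nonzero, so the default value of \<open>div\<close> does not occur.\<close>

lemma Vandermonde_mult_schur:
  "Vandermonde N mfps_var * schur N l =
    (alternant N (\<lambda>j. part l j + N - j) mfps_var :: 'a :: idom mfps)"
proof -
  let ?a = "alternant N (\<lambda>j. part l j + N - j) mfps_var :: 'a mfps"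
  obtain q where q: "?a = Vandermonde N mfps_var * q"
    using Vandermonde_dvd_alternant by (rule dvdE)
  have "schur N l = ?a div Vandermonde N mfps_var"
    by (simp add: schur_def alternant_def Vandermonde_def)
  also have "\<dots> = q"
    unfolding q by (rule nonzero_mult_div_cancel_left[OF Vandermonde_var_nonzero])
  finally show ?thesis using q by simp
qed

lemma alternant_paired_partition:
  assumes l: "l \<in> paired_partitions n"
  shows "alternant (2*n) (\<lambda>j. part l j + 2*n - j) x =
    alternant (2*n) (pair_exponents (half_exponents n l)) x"
proof (rule alternant_cong)
  fix j assume "j \<in> {1..2*n}"
  then show "part l j + 2*n - j = pair_exponents (half_exponents n l) j"
  proof (cases rule: pairs_cases)
    case (1 k)
    then show ?thesis by (simp only: pair_exponents_even half_exponents_apply)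
  next
    case (2 k)
    then have "1 \<le> k" "k \<le> n" by auto
    then have "part l (2*k) + 2*n - (2*k - 1) = part l (2*k) + 2*n - 2*k + 1" by simp
    then show ?thesis
      using paired_partitionsD[OF l 2(1)] pair_exponents_odd[OF \<open>1 \<le> k\<close>]
      by (simp only: 2(2) half_exponents_apply[OF 2(1)])
  qed
qed

lemma prod_even_indices:
  "(\<Prod>i\<in>{i \<in> {2..2*n}. even i}. f i) = (\<Prod>k\<in>{1..n::nat}. f (2*k))"
  by (rule prod.reindex_bij_witness[of _ "\<lambda>k. 2*k" "\<lambda>i. i div 2"]) auto

lemma bij_betw_half_exponents:
  "bij_betw (half_exponents n)
     {l \<in> paired_partitions n. half_exponents n l \<in> separated_exponents n D} (separated_exponents n D)"
proof (rule bij_betw_imageI)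
  show "inj_on (half_exponents n) {l \<in> paired_partitions n. half_exponents n l \<in> separated_exponents n D}"
    by (rule inj_on_subset[OF inj_on_half_exponents]) auto
  show "half_exponents n ` {l \<in> paired_partitions n. half_exponents n l \<in> separated_exponents n D} =
      separated_exponents n D"
    using separated_exponents_surj[of _ n D] by (auto simp: image_iff)
qed

section \<open>Summation over paired partitions\<close>

definition summand :: "nat \<Rightarrow> nat list \<Rightarrow> 'a :: idom poly mfps" where
  "summand n l = (\<Prod>i\<in>{i \<in> {2..2*n}. even i}. 1 - mfps_t ^ (part l i + 2*n + 1 - i)) * schur (2*n) l"

text \<open>The fraction in the Pfaffian realized as a power series, so that it can be truncated;
  \<open>to_fract_entry\<close> identifies the two.\<close>

definition entry :: "nat \<Rightarrow> nat \<Rightarrow> 'a :: idom poly mfps" where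
  "entry i j = (mfps_var i - mfps_var j) *
     mfps_series (\<lambda>m. 1 - mfps_t ^ (m + 1)) (mfps_var i * mfps_var j)"

text \<open>The exponent of \<open>t\<close> at \<open>i = 2*k\<close> is
  \<open>half_exponents n l k + 1\<close>, so each factor is the coefficient of \<open>u ^ m\<close>
  in the expansion of an entry, with \<open>m\<close> the half exponent.\<close>

lemma Vandermonde_mult_summand:
  assumes "l \<in> paired_partitions n"
  shows "Vandermonde (2*n) mfps_var * summand n l =
    (\<Prod>k\<in>{1..n}. 1 - mfps_t ^ (half_exponents n l k + 1)) *
      (alternant (2*n) (pair_exponents (half_exponents n l)) mfps_var :: 'a :: idom poly mfps)"
proof -
  have "part l (2*k) + 2*n + 1 - 2*k = half_exponents n l k + 1" if "k \<in> {1..n}" for k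
    using that by (auto simp: half_exponents_apply)
  then have "(\<Prod>i\<in>{i \<in> {2..2*n}. even i}. 1 - mfps_t ^ (part l i + 2*n + 1 - i)) =
      (\<Prod>k\<in>{1..n}. 1 - mfps_t ^ (half_exponents n l k + 1) :: 'a poly mfps)"
    unfolding prod_even_indices by (intro prod.cong refl) simp
  then show ?thesis
    unfolding summand_def alternant_paired_partition[OF assms, symmetric] Vandermonde_mult_schur[symmetric]
    by (simp add: mult_ac)
qed

lemma mfps_cong_var_product: "mfps_cong 1 (mfps_var i * mfps_var j :: 'a :: comm_ring_1 mfps) 0"
  using mfps_cong_0_mult_left[OF mfps_cong_0_var_power[of 1 i]] by simp

lemma mfps_cong_entry:
  "mfps_cong D (entry i j :: 'a :: idom poly mfps)
    (\<Sum>m<D. (1 - mfps_t ^ (m + 1)) *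
      (mfps_var i ^ (m + 1) * mfps_var j ^ m - mfps_var i ^ m * mfps_var j ^ (m + 1)))"
proof -
  have "mfps_cong D (entry i j :: 'a poly mfps) ((mfps_var i - mfps_var j) *
      (\<Sum>m<D. (1 - mfps_t ^ (m + 1)) * (mfps_var i * mfps_var j) ^ m))"
    unfolding entry_def
    by (intro mfps_cong_mult mfps_cong_refl mfps_cong_series mfps_cong_var_product)
  also have "(mfps_var i - mfps_var j) *
      (\<Sum>m<D. (1 - mfps_t ^ (m + 1)) * (mfps_var i * mfps_var j) ^ m) =
    (\<Sum>m<D. (1 - mfps_t ^ (m + 1)) *
      (mfps_var i ^ (m + 1) * mfps_var j ^ m - mfps_var i ^ m * mfps_var j ^ (m + 1)) :: 'a poly mfps)"
    unfolding sum_distrib_left by (intro sum.cong refl) (simp add: power_mult_distrib algebra_simps)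
  finally show ?thesis .
qed

lemma to_fract_entry:
  "to_fract (entry i j :: 'a :: idom poly mfps) =
    (fx i - fx j) * (1 - ft) / ((1 - fx i * fx j) * (1 - ft * fx i * fx j))"
proof -
  let ?u = "mfps_var i * mfps_var j :: 'a poly mfps"
  let ?d = "(1 - ?u) * (1 - mfps_t * ?u)"
  have "mfps_nth ?u 0 = 0"
    using mfps_congD[OF mfps_cong_var_product, of 0] by (simp add: pm_deg_def)
  \<comment> \<open>Constant coefficient 1 makes the denominator nonzero, which permits division of
    the cross-multiplied identity in the field of fractions.\<close>
  then have "mfps_nth ?d 0 = 1" by (auto simp: mfps_nth_mult[of _ _ 0])
  then have d: "?d \<noteq> 0" by auto
  have "entry i j * ?d = (mfps_var i - mfps_var j) *
      (?d * mfps_series (\<lambda>m. 1 - mfps_t ^ (m + 1)) ?u)"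
    by (simp only: entry_def mult_ac)
  also have "?d * mfps_series (\<lambda>m. 1 - mfps_t ^ (m + 1)) ?u = 1 - mfps_t"
    by (rule geometric_difference_series[OF mfps_cong_var_product])
  finally have "entry i j * ?d = (mfps_var i - mfps_var j) * (1 - mfps_t)" .
  then have eq: "to_fract (entry i j) * to_fract ?d = to_fract ((mfps_var i - mfps_var j) * (1 - mfps_t))"
    by (metis to_fract_mult)
  have "to_fract ?d \<noteq> 0" using d unfolding to_fract_eq_0_iff .
  from nonzero_eq_divide_eq[OF this, THEN iffD2, OF eq]
  have "to_fract (entry i j) = to_fract ((mfps_var i - mfps_var j) * (1 - mfps_t)) / to_fract ?d" .
  then show ?thesis by (simp add: mult.assoc)
qed

lemma has_sum_summand:
  obtains S where "(summand n has_sum (S :: 'a :: idom poly mfps)) (paired_partitions n)"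
    "Vandermonde (2*n) mfps_var * S = pfaffian n entry"
proof -
  let ?V = "Vandermonde (2*n) mfps_var :: 'a poly mfps"
  let ?c = "\<lambda>m. 1 - mfps_t ^ (m + 1) :: 'a poly mfps"
  let ?g = "\<lambda>m. (\<Prod>k\<in>{1..n}. ?c (m k)) * (alternant (2*n) (pair_exponents m) mfps_var :: 'a poly mfps)"
  obtain d where d: "homogeneous d ?V" by (rule homogeneous_Vandermonde)
  \<comment> \<open>The additional \<open>d\<close> compensates for the loss of precision when the
    Vandermonde product is cancelled.\<close>
  define L where "L D = {l \<in> paired_partitions n. half_exponents n l \<in> separated_exponents n (d + D)}" for D
  have bij: "bij_betw (half_exponents n) (L D) (separated_exponents n (d + D))" for D
    unfolding L_def by (rule bij_betw_half_exponents)
  have fin: "finite (L D)" for D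
    using bij_betw_finite[OF bij] finite_subset[OF separated_subset_decreasing finite_decreasing_exponents]
    by blast
  have small: "mfps_cong D (summand n l :: 'a poly mfps) 0" if l: "l \<in> paired_partitions n" "l \<notin> L D" for l D
  proof (rule mfps_cong_0_cancel[OF d Vandermonde_var_nonzero])
    \<comment> \<open>The gap condition holds for every paired partition, so being outside
      \<open>L D\<close> can only mean that some exponent exceeds the bound.\<close>
    obtain k where k: "k \<in> {1..n}" "d + D \<le> half_exponents n l k"
      using half_exponents_separated[OF l(1), of "d + D"] l by (fastforce simp: L_def)
    have "mfps_cong (d + D) (alternant (2*n) (pair_exponents (half_exponents n l)) mfps_var :: 'a poly mfps) 0"
      by (rule mfps_cong_0_alternant[of "2*k"]) (use k in \<open>auto simp: pair_exponents_even\<close>)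
    then show "mfps_cong (d + D) (?V * summand n l) 0"
      unfolding Vandermonde_mult_summand[OF l(1)] by (subst mult.commute) (rule mfps_cong_0_mult_left)
  qed
  obtain S where S: "(summand n has_sum (S :: 'a poly mfps)) (paired_partitions n)"
    "\<And>D. mfps_cong D S (\<Sum>l\<in>L D. summand n l)"
    by (rule has_sum_mfps_filtered[of L "paired_partitions n" "summand n", OF fin _ small])
      (auto simp: L_def)
  have "?V * S = pfaffian n entry"
  proof (rule mfps_eq_if_cong)
    fix D
    have "mfps_cong D (?V * S) (?V * (\<Sum>l\<in>L D. summand n l))"
      by (intro mfps_cong_mult mfps_cong_refl S)
    also have "?V * (\<Sum>l\<in>L D. summand n l) = (\<Sum>l\<in>L D. ?g (half_exponents n l))"
      unfolding sum_distrib_left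
      by (intro sum.cong refl) (simp only: L_def mem_Collect_eq Vandermonde_mult_summand)
    also have "\<dots> = (\<Sum>m\<in>separated_exponents n (d + D). ?g m)"
      by (rule sum.reindex_bij_betw[OF bij])
    also have "\<dots> = pfaffian n (\<lambda>i j. \<Sum>m<d + D. ?c m *
        (mfps_var i ^ (m + 1) * mfps_var j ^ m - mfps_var i ^ m * mfps_var j ^ (m + 1)))"
      by (rule pfaffian_expand_separated[symmetric])
    \<comment> \<open>The truncated entries are correct below degree \<open>d + D\<close>, hence
      also below \<open>D\<close>. As \<open>D\<close> is arbitrary, the two series
      coincide.\<close>
    also have "mfps_cong D \<dots> (pfaffian n entry)"
      by (rule mfps_cong_mono[OF mfps_cong_sym[OF mfps_cong_pfaffian[OF mfps_cong_entry]]]) simp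
    finally show "mfps_cong D (?V * S) (pfaffian n entry)" .
  qed
  with S(1) show thesis by (rule that)
qed

theorem theorem4:
  fixes n :: nat
  assumes "n \<ge> 1"
  shows "\<exists>S :: 'a :: idom poly mfps.
    ((\<lambda>l. (\<Prod>i\<in>{i \<in> {2..2*n}. even i}. 1 - mfps_t ^ (part l i + 2*n + 1 - i)) * schur (2*n) l)
      has_sum S) {l. is_partition l \<and> length l \<le> 2*n \<and> even_parts (conjugate_partition l)} \<and>
    to_fract S =
      (\<Prod>(i, j)\<in>{(i, j). 1 \<le> i \<and> i < j \<and> j \<le> 2*n}. 1 / (fx i - fx j)) *
      pfaffian n (\<lambda>i j. (fx i - fx j) * (1 - ft) / ((1 - fx i * fx j) * (1 - ft * fx i * fx j)))"
proof -
  obtain S :: "'a poly mfps" where S: "(summand n has_sum S) (paired_partitions n)"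
    "Vandermonde (2*n) mfps_var * S = pfaffian n entry"
    by (rule has_sum_summand)
  have V: "to_fract (Vandermonde (2*n) mfps_var :: 'a poly mfps) \<noteq> 0"
    using Vandermonde_var_nonzero by simp
  have "to_fract (Vandermonde (2*n) mfps_var) * to_fract S = to_fract (pfaffian n entry)"
    using S(2) by (metis to_fract_mult)
  then have "to_fract S = 1 / to_fract (Vandermonde (2*n) mfps_var) * pfaffian n (\<lambda>i j. to_fract (entry i j))"
    using V by (simp add: to_fract_pfaffian field_simps)
  moreover have "1 / to_fract (Vandermonde (2*n) mfps_var :: 'a poly mfps) =
      (\<Prod>(i, j)\<in>{(i, j). 1 \<le> i \<and> i < j \<and> j \<le> 2*n}. 1 / (fx i - fx j))"
    by (simp add: Vandermonde_def to_fract_prod case_prod_unfold prod_dividef)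
  ultimately show ?thesis
    using S(1) unfolding to_fract_entry summand_def[abs_def] paired_partitions_def by auto
qed

end
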